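(* Let $\omega\subset\mathbb{R}^2$ be a domain, $\varepsilon>0$, $p\geqslant2$, $q>1$, $\gamma_0$ a non-empty relatively open subset of $\partial\omega$, and let $\boldsymbol{\varphi}\in G^1$ be the midsurface parametrization of a $G^1$ shell with thickness $2\varepsilon$, with associated unit normal $\boldsymbol{a}_3$, contravariant vectors $\boldsymbol{g}^\alpha(x,v)$ and set of admissible deformations $\boldsymbol{V}^{\varepsilon}$ (all defined in the context). Let $$\boldsymbol{N}:=\{(a,b,c)\in\mathbb{R}^3;\ a-|b|>0\text{ and }a-2|b|+c>0\}$$ and let $\Gamma:\omega\times\boldsymbol{N}\to\mathbb{R}$ be a function such that $\Gamma(x,\cdot):\boldsymbol{N}\to\mathbb{R}$ is convex for almost all $x\in\omega$. Let $R\geqslant1$ be an integer and, for $1\leqslant i\leqslant R$, let $a_i>0$, $b_i>0$, $\gamma_i\geqslant2$, $u_i\in\mathbb{R}$, $(v_i,w_i)\in[-\varepsilon,\varepsilon]^2$. Let $W:\omega\times\boldsymbol{V}^{\varepsilon}\to\mathbb{R}$ be defined by $$\begin{aligned}W(x,\boldsymbol{\psi})=\sum_{i=1}^R&\Big\{a_i\,\mathrm{tr}\big(\boldsymbol{G}(x,\boldsymbol{\psi},u_i,v_i)^{\gamma_i/2}\big)+b_i\,\mathrm{tr}\big(\boldsymbol{G}(x,\boldsymbol{\psi},-u_i,w_i)^{\gamma_i/2}\big)\Big\}\\&+\Gamma\big(x,\sqrt{a(\boldsymbol{\psi})},\varepsilon H(\boldsymbol{\psi})\sqrt{a(\boldsymbol{\psi})},\varepsilon^2K(\boldsymbol{\psi})\sqrt{a(\boldsymbol{\psi})}\big),\end{aligned}$$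 where $$\boldsymbol{G}(x,\boldsymbol{\psi},u,v):=\{a_{\alpha\beta}(\boldsymbol{\psi})-2u\,b_{\alpha\beta}(\boldsymbol{\psi})+u^2c_{\alpha\beta}(\boldsymbol{\psi})\}\,\boldsymbol{g}^\alpha(x,v)\otimes\boldsymbol{g}^\beta(x,v).$$ Then $W$ is polyconvex, and, with $i_0$ such that $\gamma_{i_0}=\max_i\gamma_i$, there is a constant $C>0$ such that $$W(x,\boldsymbol{\psi})\geqslant C\{|\nabla\boldsymbol{\psi}|^{\gamma_{i_0}}+|u_{i_0}|^{\gamma_{i_0}}|\nabla\boldsymbol{a}_3(\boldsymbol{\psi})|^{\gamma_{i_0}}\}+\Gamma\big(x,\sqrt{a(\boldsymbol{\psi})},\varepsilon H(\boldsymbol{\psi})\sqrt{a(\boldsymbol{\psi})},\varepsilon^2K(\boldsymbol{\psi})\sqrt{a(\boldsymbol{\psi})}\big)$$ for all $\boldsymbol{\psi}\in\boldsymbol{V}^{\varepsilon}$ and almost all $x\in\omega$.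
   Context: A domain $\omega\subset\mathbb{R}^2$ is a bounded, connected, open set with Lipschitz-continuous boundary, $\omega$ being locally on the same side of its boundary. Greek indices range in $\{1,2\}$ and repeated indices are summed. $\partial_\alpha=\partial/\partial x_\alpha$ (distributional), $\wedge$ is the vector product in $\mathbb{R}^3$, $\otimes$ the tensor product of vectors of $\mathbb{R}^3$ (a $3\times3$ matrix), $\mathbb{M}^{m\times n}$ the set of real $m\times n$ matrices, and $|\boldsymbol{A}|=\mathrm{tr}(\boldsymbol{A}^{\mathrm{T}}\boldsymbol{A})^{1/2}$ the Frobenius norm. $\nabla\boldsymbol{\psi}$ is the $3\times2$ matrix field with columns $\partial_1\boldsymbol{\psi},\partial_2\boldsymbol{\psi}$. Surface quantities. For $\boldsymbol{\psi}:\omega\to\mathbb{R}^3$ of Sobolev class put $a_{\alpha\beta}(\boldsymbol{\psi}):=\partial_\alpha\boldsymbol{\psi}\cdot\partial_\beta\boldsymbol{\psi}$ and $a(\boldsymbol{\psi}):=|\partial_1\boldsymbol{\psi}\wedge\partial_2\boldsymbol{\psi}|^2=\det(a_{\alpha\beta}(\boldsymbol{\psi}))$. If $a(\boldsymbol{\psi})\neq0$ a.e., put $\boldsymbol{a}_3(\boldsymbol{\psi}):=(\partial_1\boldsymbol{\psi}\wedge\partial_2\boldsymbol{\psi})/|\partial_1\boldsymbol{\psi}\wedge\partial_2\boldsymbol{\psi}|$, $(a^{\alpha\beta}(\boldsymbol{\psi})):=(a_{\alpha\beta}(\boldsymbol{\psi}))^{-1}$ and, if $\boldsymbol{a}_3(\boldsymbol{\psi})$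 is of Sobolev class, $$b_{\alpha\beta}(\boldsymbol{\psi}):=-\partial_\alpha\boldsymbol{\psi}\cdot\partial_\beta\boldsymbol{a}_3(\boldsymbol{\psi}),\quad c_{\alpha\beta}(\boldsymbol{\psi}):=\partial_\alpha\boldsymbol{a}_3(\boldsymbol{\psi})\cdot\partial_\beta\boldsymbol{a}_3(\boldsymbol{\psi}),\quad b_\alpha^\beta(\boldsymbol{\psi}):=b_{\alpha\rho}(\boldsymbol{\psi})a^{\rho\beta}(\boldsymbol{\psi}).$$ The principal curvatures $1/R_1(\boldsymbol{\psi}),1/R_2(\boldsymbol{\psi})$ are the eigenvalues of $(b_\alpha^\beta(\boldsymbol{\psi}))$ (so $\varepsilon/R_\alpha$ means $\varepsilon$ times the principal curvature); $H(\boldsymbol{\psi}):=\frac12(\frac1{R_1(\boldsymbol{\psi})}+\frac1{R_2(\boldsymbol{\psi})})$ and $K(\boldsymbol{\psi}):=\frac1{R_1(\boldsymbol{\psi})R_2(\boldsymbol{\psi})}$. In expressions such as $W(x,\boldsymbol\psi)$ and $\boldsymbol G(x,\boldsymbol\psi,u,v)$ all these functions are evaluated at $x$. $G^1$ shells. For $\boldsymbol{\varphi}\in W^{1,\infty}(\omega;\mathbb{R}^3)$ write $\boldsymbol{a}_\alpha:=\partial_\alpha\boldsymbol{\varphi}$, $\boldsymbol{a}_3:=\boldsymbol{a}_3(\boldsymbol{\varphi})$, $R_\alpha:=R_\alpha(\boldsymbol{\varphi})$. Then $$G^1:=\Big\{\boldsymbol{\varphi}\in W^{1,\infty}(\omega;\mathbb{R}^3);\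 \tfrac{\boldsymbol{a}_1\wedge\boldsymbol{a}_2}{|\boldsymbol{a}_1\wedge\boldsymbol{a}_2|}\in W^{1,\infty}(\omega;\mathbb{R}^3),\ \operatorname*{ess\,inf}_\omega|\boldsymbol{a}_1\wedge\boldsymbol{a}_2|>0,\ \max_{\alpha\in\{1,2\}}\|\varepsilon/R_\alpha\|_{L^\infty(\omega)}<1\Big\}.$$ For $|v|\leqslant\varepsilon$ the tangent vectors are $\boldsymbol{g}_\alpha(x,v):=\boldsymbol{a}_\alpha(x)+v\,\partial_\alpha\boldsymbol{a}_3(x)$, and the contravariant vectors $\boldsymbol{g}^\alpha(x,v)$ are the vectors in the span of $\boldsymbol{g}_1(x,v),\boldsymbol{g}_2(x,v)$ with $\boldsymbol{g}^\alpha(x,v)\cdot\boldsymbol{g}_\beta(x,v)=\delta^\alpha_\beta$. Admissible deformations. $\boldsymbol{V}^{\varepsilon}$ is the set of $\boldsymbol{\psi}\in W^{1,p}(\omega;\mathbb{R}^3)$ such that $\sqrt{a(\boldsymbol{\psi})}\in L^q(\omega)$, $a(\boldsymbol{\psi})\ne0$ a.e. in $\omega$, $\boldsymbol{a}_3(\boldsymbol{\psi})\in W^{1,p}(\omega;\mathbb{R}^3)$, $\max\{|\varepsilon/R_1(\boldsymbol{\psi})|,|\varepsilon/R_2(\boldsymbol{\psi})|\}<1$ a.e. in $\omega$, and $\boldsymbol{\psi}=\boldsymbol{\varphi}$, $\boldsymbol{a}_3(\boldsymbol{\psi})=\boldsymbol{a}_3$ a.e. on $\gamma_0$ (in the sense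 of traces). For a symmetric positive semidefinite matrix $\boldsymbol{G}$ and $s>0$, $\boldsymbol{G}^{s}$ is the usual power defined through the spectral decomposition. Polyconvexity. A function $W:\omega\times\boldsymbol{V}^{\varepsilon}\to\mathbb{R}$ is polyconvex if for almost all $x\in\omega$ there exists a convex function $\mathbb{W}(x,\cdot):\boldsymbol{M}\to\mathbb{R}$, where $\boldsymbol{M}:=\{(\boldsymbol{A},\boldsymbol{B},a,b,c)\in(\mathbb{M}^{3\times2})^2\times\mathbb{R}^3;\ a-|b|>0\text{ and }a-2|b|+c>0\}$, such that for all $\boldsymbol{\psi}\in\boldsymbol{V}^{\varepsilon}$ and almost all $x\in\omega$, $$W(x,\boldsymbol{\psi})=\mathbb{W}\Big(x,\nabla\boldsymbol{\psi}(x),\nabla\boldsymbol{a}_3(\boldsymbol{\psi})(x),\big(1,\varepsilon H(\boldsymbol{\psi}),\varepsilon^2K(\boldsymbol{\psi})\big)(x)\sqrt{a(\boldsymbol{\psi})(x)}\Big).$$ *)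

theory Defs
  imports "HOL-Analysis.Analysis" "HOL-Probability.Essential_Supremum"
begin

text \<open>
  Elements of Lebesgue and Sobolev spaces over \<open>\<omega>\<close> are represented by functions on the whole plane;
  only their values almost everywhere in \<open>\<omega>\<close> matter.
\<close>

section \<open>Lipschitz domains\<close>

definition lipschitz_boundary :: "(real^2) set \<Rightarrow> bool" where
  "lipschitz_boundary \<omega> \<longleftrightarrow>
     (\<forall>x0 \<in> frontier \<omega>. \<exists>(e::real^2) n (h::real \<Rightarrow> real) L r s.
        norm e = 1 \<and> norm n = 1 \<and> e \<bullet> n = 0 \<and> r > 0 \<and> s > 0 \<and> L-lipschitz_on UNIV h \<and>
        (\<forall>y. \<bar>(y - x0) \<bullet> e\<bar> < r \<and> \<bar>(y - x0) \<bullet> n\<bar> < s \<longrightarrow>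
             (y \<in> \<omega> \<longleftrightarrow> (y - x0) \<bullet> n > h ((y - x0) \<bullet> e))))"

definition lipschitz_domain :: "(real^2) set \<Rightarrow> bool" where
  "lipschitz_domain \<omega> \<longleftrightarrow> bounded \<omega> \<and> connected \<omega> \<and> open \<omega> \<and> lipschitz_boundary \<omega>"

section \<open>Weak derivatives and Sobolev spaces\<close>

definition partial_deriv :: "2 \<Rightarrow> (real^2 \<Rightarrow> 'b::real_normed_vector) \<Rightarrow> real^2 \<Rightarrow> 'b" where
  "partial_deriv \<alpha> f x = frechet_derivative f (at x) (axis \<alpha> 1)"

primrec C_k :: "nat \<Rightarrow> (real^2 \<Rightarrow> 'b::real_normed_vector) \<Rightarrow> bool" where
  "C_k 0 f \<longleftrightarrow> continuous_on UNIV f"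
| "C_k (Suc k) f \<longleftrightarrow> (\<forall>x. f differentiable (at x)) \<and> (\<forall>\<alpha>. C_k k (partial_deriv \<alpha> f))"

definition smooth :: "(real^2 \<Rightarrow> 'b::real_normed_vector) \<Rightarrow> bool" where
  "smooth f \<longleftrightarrow> (\<forall>k. C_k k f)"

definition test_function :: "(real^2) set \<Rightarrow> (real^2 \<Rightarrow> real) \<Rightarrow> bool" where
  "test_function \<omega> \<theta> \<longleftrightarrow>
     smooth \<theta> \<and> compact (closure {x. \<theta> x \<noteq> 0}) \<and> closure {x. \<theta> x \<noteq> 0} \<subseteq> \<omega>"

definition locally_integrable :: "(real^2) set \<Rightarrow> (real^2 \<Rightarrow> real^3) \<Rightarrow> bool" where
  "locally_integrable \<omega> f \<longleftrightarrow> (\<forall>K. compact K \<and> K \<subseteq> \<omega> \<longrightarrow> f absolutely_integrable_on K)"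

definition has_weak_partial ::
    "(real^2) set \<Rightarrow> 2 \<Rightarrow> (real^2 \<Rightarrow> real^3) \<Rightarrow> (real^2 \<Rightarrow> real^3) \<Rightarrow> bool" where
  "has_weak_partial \<omega> \<alpha> f g \<longleftrightarrow> locally_integrable \<omega> f \<and> locally_integrable \<omega> g \<and>
     (\<forall>\<theta>. test_function \<omega> \<theta> \<longrightarrow>
        (LINT x|lebesgue_on \<omega>. partial_deriv \<alpha> \<theta> x *\<^sub>R f x) = - (LINT x|lebesgue_on \<omega>. \<theta> x *\<^sub>R g x))"

text \<open>
  A representative of the weak derivative, which is unique up to null sets. The choice depends on \<open>f\<close>
  only through its class modulo equality almost everywhere in \<open>\<omega>\<close>.
\<close>
definition weak_partial ::
    "(real^2) set \<Rightarrow> 2 \<Rightarrow> (real^2 \<Rightarrow> real^3) \<Rightarrow> real^2 \<Rightarrow> real^3" where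
  "weak_partial \<omega> \<alpha> f = (SOME g. has_weak_partial \<omega> \<alpha> f g)"

definition Lp :: "real \<Rightarrow> (real^2) set \<Rightarrow> (real^2 \<Rightarrow> 'b::euclidean_space) set" where
  "Lp p \<omega> = {f \<in> borel_measurable (lebesgue_on \<omega>).
              integrable (lebesgue_on \<omega>) (\<lambda>x. norm (f x) powr p)}"

definition Linf :: "(real^2) set \<Rightarrow> (real^2 \<Rightarrow> 'b::euclidean_space) set" where
  "Linf \<omega> = {f \<in> borel_measurable (lebesgue_on \<omega>).
              esssup (lebesgue_on \<omega>) (\<lambda>x. ereal (norm (f x))) < \<infinity>}"

text \<open>The functions of a space \<open>L\<close> whose first-order weak derivatives lie in \<open>L\<close>.\<close>
definition sobolev1 ::
    "(real^2) set \<Rightarrow> (real^2 \<Rightarrow> real^3) set \<Rightarrow> (real^2 \<Rightarrow> real^3) set" where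
  "sobolev1 \<omega> L = {f \<in> L. \<forall>\<alpha>. \<exists>g \<in> L. has_weak_partial \<omega> \<alpha> f g}"

abbreviation W1p :: "real \<Rightarrow> (real^2) set \<Rightarrow> (real^2 \<Rightarrow> real^3) set" where
  "W1p p \<omega> \<equiv> sobolev1 \<omega> (Lp p \<omega>)"

abbreviation W1inf :: "(real^2) set \<Rightarrow> (real^2 \<Rightarrow> real^3) set" where
  "W1inf \<omega> \<equiv> sobolev1 \<omega> (Linf \<omega>)"

definition essinf :: "'a measure \<Rightarrow> ('a \<Rightarrow> real) \<Rightarrow> ereal" where
  "essinf M f = - esssup M (\<lambda>x. - ereal (f x))"

section \<open>Traces\<close>

text \<open>
  One-dimensional Hausdorff measure. Boundedness of the covering sets has to be required separately,
  since the diameter of an unbounded set is unspecified.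
\<close>
definition hausdorff1_pre :: "real \<Rightarrow> (real^2) set \<Rightarrow> ennreal" where
  "hausdorff1_pre \<delta> A =
     (INF U \<in> {U :: nat \<Rightarrow> (real^2) set. A \<subseteq> (\<Union>i. U i) \<and> (\<forall>i. bounded (U i) \<and> diameter (U i) \<le> \<delta>)}.
        \<Sum>i. ennreal (diameter (U i)))"

definition hausdorff1_outer :: "(real^2) set \<Rightarrow> ennreal" where
  "hausdorff1_outer A = (SUP \<delta> \<in> {0<..}. hausdorff1_pre \<delta> A)"

text \<open>
  The outer measure is a metric outer measure, hence countably additive on the Borel sets
  (so that the measure space below carries its values, not the default zero measure).
\<close>
definition hausdorff1 :: "(real^2) measure" where
  "hausdorff1 = measure_of UNIV (sets borel) hausdorff1_outer"

definition boundary_measure :: "(real^2) set \<Rightarrow> (real^2) measure" where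
  "boundary_measure \<omega> = restrict_space hausdorff1 (frontier \<omega>)"

text \<open>
  The trace is the continuous extension to \<open>W\<^sup>1\<^sup>,\<^sup>p\<close> of the restriction to the boundary of functions
  smooth up to the boundary (which are dense).
\<close>
definition has_trace ::
    "real \<Rightarrow> (real^2) set \<Rightarrow> (real^2 \<Rightarrow> real^3) \<Rightarrow> (real^2 \<Rightarrow> real^3) \<Rightarrow> bool" where
  "has_trace p \<omega> f t \<longleftrightarrow> t \<in> borel_measurable (boundary_measure \<omega>) \<and>
     (\<exists>F :: nat \<Rightarrow> real^2 \<Rightarrow> real^3. (\<forall>n. smooth (F n)) \<and>
        (\<lambda>n. \<integral>\<^sup>+x. ennreal (norm (F n x - f x) powr p) \<partial>lebesgue_on \<omega>) \<longlonglongrightarrow> 0 \<and>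
        (\<forall>\<alpha>. (\<lambda>n. \<integral>\<^sup>+x. ennreal (norm (partial_deriv \<alpha> (F n) x - weak_partial \<omega> \<alpha> f x) powr p)
                     \<partial>lebesgue_on \<omega>) \<longlonglongrightarrow> 0) \<and>
        (\<lambda>n. \<integral>\<^sup>+x. ennreal (norm (F n x - t x) powr p) \<partial>boundary_measure \<omega>) \<longlonglongrightarrow> 0)"

definition trace_eq_on ::
    "real \<Rightarrow> (real^2) set \<Rightarrow> (real^2) set \<Rightarrow> (real^2 \<Rightarrow> real^3) \<Rightarrow> (real^2 \<Rightarrow> real^3) \<Rightarrow> bool" where
  "trace_eq_on p \<omega> \<gamma>\<^sub>0 f g \<longleftrightarrow>
     (\<exists>s t. has_trace p \<omega> f s \<and> has_trace p \<omega> g t \<and>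
        (AE x in boundary_measure \<omega>. x \<in> \<gamma>\<^sub>0 \<longrightarrow> s x = t x))"

section \<open>Geometry of surfaces\<close>

definition grad :: "(real^2) set \<Rightarrow> (real^2 \<Rightarrow> real^3) \<Rightarrow> real^2 \<Rightarrow> real^2^3" where
  "grad \<omega> \<psi> x = (\<chi> i \<alpha>. weak_partial \<omega> \<alpha> \<psi> x $ i)"

definition frobenius :: "real^'n^'m \<Rightarrow> real" where
  "frobenius A = sqrt (trace (transpose A ** A))"

definition tensor :: "real^'m \<Rightarrow> real^'n \<Rightarrow> real^'n^'m" where
  "tensor u w = (\<chi> i j. u $ i * w $ j)"

definition normal_field :: "(real^2) set \<Rightarrow> (real^2 \<Rightarrow> real^3) \<Rightarrow> real^2 \<Rightarrow> real^3" where
  "normal_field \<omega> \<psi> x = cross3 (weak_partial \<omega> 1 \<psi> x) (weak_partial \<omega> 2 \<psi> x)"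

definition area :: "(real^2) set \<Rightarrow> (real^2 \<Rightarrow> real^3) \<Rightarrow> real^2 \<Rightarrow> real" where
  "area \<omega> \<psi> x = (norm (normal_field \<omega> \<psi> x))\<^sup>2"

definition a3 :: "(real^2) set \<Rightarrow> (real^2 \<Rightarrow> real^3) \<Rightarrow> real^2 \<Rightarrow> real^3" where
  "a3 \<omega> \<psi> x = (1 / norm (normal_field \<omega> \<psi> x)) *\<^sub>R normal_field \<omega> \<psi> x"

definition form_a :: "(real^2) set \<Rightarrow> (real^2 \<Rightarrow> real^3) \<Rightarrow> real^2 \<Rightarrow> real^2^2" where
  "form_a \<omega> \<psi> x = (\<chi> \<alpha> \<beta>. weak_partial \<omega> \<alpha> \<psi> x \<bullet> weak_partial \<omega> \<beta> \<psi> x)"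

definition form_b :: "(real^2) set \<Rightarrow> (real^2 \<Rightarrow> real^3) \<Rightarrow> real^2 \<Rightarrow> real^2^2" where
  "form_b \<omega> \<psi> x = (\<chi> \<alpha> \<beta>. - (weak_partial \<omega> \<alpha> \<psi> x \<bullet> weak_partial \<omega> \<beta> (a3 \<omega> \<psi>) x))"

definition form_c :: "(real^2) set \<Rightarrow> (real^2 \<Rightarrow> real^3) \<Rightarrow> real^2 \<Rightarrow> real^2^2" where
  "form_c \<omega> \<psi> x = (\<chi> \<alpha> \<beta>. weak_partial \<omega> \<alpha> (a3 \<omega> \<psi>) x \<bullet> weak_partial \<omega> \<beta> (a3 \<omega> \<psi>) x)"

definition mixed_b :: "(real^2) set \<Rightarrow> (real^2 \<Rightarrow> real^3) \<Rightarrow> real^2 \<Rightarrow> real^2^2" where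
  "mixed_b \<omega> \<psi> x = form_b \<omega> \<psi> x ** matrix_inv (form_a \<omega> \<psi> x)"

definition eigenvalues :: "real^'n^'n \<Rightarrow> real set" where
  "eigenvalues A = {k. \<exists>v. v \<noteq> 0 \<and> A *v v = k *\<^sub>R v}"

text \<open>
  The two principal curvatures, numbered in increasing order. A real \<open>2 \<times> 2\<close> matrix with real spectrum
  has one or two distinct eigenvalues; a double one is both the minimum and the maximum.
\<close>
definition curvature1 :: "(real^2) set \<Rightarrow> (real^2 \<Rightarrow> real^3) \<Rightarrow> real^2 \<Rightarrow> real" where
  "curvature1 \<omega> \<psi> x = Min (eigenvalues (mixed_b \<omega> \<psi> x))"

definition curvature2 :: "(real^2) set \<Rightarrow> (real^2 \<Rightarrow> real^3) \<Rightarrow> real^2 \<Rightarrow> real" where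
  "curvature2 \<omega> \<psi> x = Max (eigenvalues (mixed_b \<omega> \<psi> x))"

definition mean_curv :: "(real^2) set \<Rightarrow> (real^2 \<Rightarrow> real^3) \<Rightarrow> real^2 \<Rightarrow> real" where
  "mean_curv \<omega> \<psi> x = (curvature1 \<omega> \<psi> x + curvature2 \<omega> \<psi> x) / 2"

definition gauss_curv :: "(real^2) set \<Rightarrow> (real^2 \<Rightarrow> real^3) \<Rightarrow> real^2 \<Rightarrow> real" where
  "gauss_curv \<omega> \<psi> x = curvature1 \<omega> \<psi> x * curvature2 \<omega> \<psi> x"

section \<open>Shells and admissible deformations\<close>

definition G1 :: "(real^2) set \<Rightarrow> real \<Rightarrow> (real^2 \<Rightarrow> real^3) set" where
  "G1 \<omega> \<epsilon> = {\<phi> \<in> W1inf \<omega>. a3 \<omega> \<phi> \<in> W1inf \<omega> \<and>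
     essinf (lebesgue_on \<omega>) (\<lambda>x. norm (normal_field \<omega> \<phi> x)) > 0 \<and>
     max (esssup (lebesgue_on \<omega>) (\<lambda>x. ereal \<bar>\<epsilon> * curvature1 \<omega> \<phi> x\<bar>))
         (esssup (lebesgue_on \<omega>) (\<lambda>x. ereal \<bar>\<epsilon> * curvature2 \<omega> \<phi> x\<bar>)) < 1}"

definition g_cov :: "(real^2) set \<Rightarrow> (real^2 \<Rightarrow> real^3) \<Rightarrow> real^2 \<Rightarrow> real \<Rightarrow> 2 \<Rightarrow> real^3" where
  "g_cov \<omega> \<phi> x v \<alpha> = weak_partial \<omega> \<alpha> \<phi> x + v *\<^sub>R weak_partial \<omega> \<alpha> (a3 \<omega> \<phi>) x"

definition g_contra :: "(real^2) set \<Rightarrow> (real^2 \<Rightarrow> real^3) \<Rightarrow> real^2 \<Rightarrow> real \<Rightarrow> 2 \<Rightarrow> real^3" where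
  "g_contra \<omega> \<phi> x v \<alpha> = (THE w. w \<in> span (range (g_cov \<omega> \<phi> x v)) \<and>
     (\<forall>\<beta>. w \<bullet> g_cov \<omega> \<phi> x v \<beta> = (if \<alpha> = \<beta> then 1 else 0)))"

definition admissible ::
    "(real^2) set \<Rightarrow> real \<Rightarrow> real \<Rightarrow> real \<Rightarrow> (real^2) set \<Rightarrow> (real^2 \<Rightarrow> real^3) \<Rightarrow> (real^2 \<Rightarrow> real^3) set" where
  "admissible \<omega> \<epsilon> p q \<gamma>\<^sub>0 \<phi> = {\<psi> \<in> W1p p \<omega>.
     (\<lambda>x. sqrt (area \<omega> \<psi> x)) \<in> Lp q \<omega> \<and>
     (AE x in lebesgue_on \<omega>. area \<omega> \<psi> x \<noteq> 0) \<and>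
     a3 \<omega> \<psi> \<in> W1p p \<omega> \<and>
     (AE x in lebesgue_on \<omega>. max \<bar>\<epsilon> * curvature1 \<omega> \<psi> x\<bar> \<bar>\<epsilon> * curvature2 \<omega> \<psi> x\<bar> < 1) \<and>
     trace_eq_on p \<omega> \<gamma>\<^sub>0 \<psi> \<phi> \<and> trace_eq_on p \<omega> \<gamma>\<^sub>0 (a3 \<omega> \<psi>) (a3 \<omega> \<phi>)}"

section \<open>Stored energy functions\<close>

definition G_tensor ::
    "(real^2) set \<Rightarrow> (real^2 \<Rightarrow> real^3) \<Rightarrow> real^2 \<Rightarrow> (real^2 \<Rightarrow> real^3) \<Rightarrow> real \<Rightarrow> real \<Rightarrow> real^3^3" where
  "G_tensor \<omega> \<phi> x \<psi> u v = (\<Sum>\<alpha>\<in>UNIV. \<Sum>\<beta>\<in>UNIV.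
     (form_a \<omega> \<psi> x $ \<alpha> $ \<beta> - 2 * u * form_b \<omega> \<psi> x $ \<alpha> $ \<beta> + u\<^sup>2 * form_c \<omega> \<psi> x $ \<alpha> $ \<beta>)
       *\<^sub>R tensor (g_contra \<omega> \<phi> x v \<alpha>) (g_contra \<omega> \<phi> x v \<beta>))"

text \<open>
  Only meant for symmetric positive semidefinite \<open>A\<close> and \<open>s > 0\<close>; note \<open>0 powr s = 0\<close>. The power does not
  depend on the spectral decomposition.
\<close>
definition mat_powr :: "real^'n^'n \<Rightarrow> real \<Rightarrow> real^'n^'n" where
  "mat_powr A s = (THE P. \<exists>(e :: 'n \<Rightarrow> real^'n) (l :: 'n \<Rightarrow> real).
     (\<forall>i j. e i \<bullet> e j = (if i = j then 1 else 0)) \<and>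
     A = (\<Sum>i\<in>UNIV. l i *\<^sub>R tensor (e i) (e i)) \<and>
     P = (\<Sum>i\<in>UNIV. (l i powr s) *\<^sub>R tensor (e i) (e i)))"

definition N_set :: "(real \<times> real \<times> real) set" where
  "N_set = {(a, b, c). a - \<bar>b\<bar> > 0 \<and> a - 2 * \<bar>b\<bar> + c > 0}"

definition M_set :: "((real^2^3) \<times> (real^2^3) \<times> real \<times> real \<times> real) set" where
  "M_set = {(A, B, a, b, c). a - \<bar>b\<bar> > 0 \<and> a - 2 * \<bar>b\<bar> + c > 0}"

text \<open>The triple \<open>(1, \<epsilon>H, \<epsilon>\<^sup>2K) \<surd>a\<close>.\<close>
definition curv_args ::
    "(real^2) set \<Rightarrow> real \<Rightarrow> (real^2 \<Rightarrow> real^3) \<Rightarrow> real^2 \<Rightarrow> real \<times> real \<times> real" where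
  "curv_args \<omega> \<epsilon> \<psi> x =
     (sqrt (area \<omega> \<psi> x),
      \<epsilon> * mean_curv \<omega> \<psi> x * sqrt (area \<omega> \<psi> x),
      \<epsilon>\<^sup>2 * gauss_curv \<omega> \<psi> x * sqrt (area \<omega> \<psi> x))"

text \<open>
  The convex functions are defined on \<open>M_set\<close> only, so that membership of the argument in \<open>M_set\<close> is
  part of the representation of \<open>W\<close>.
\<close>
definition polyconvex ::
    "(real^2) set \<Rightarrow> real \<Rightarrow> (real^2 \<Rightarrow> real^3) set \<Rightarrow> (real^2 \<Rightarrow> (real^2 \<Rightarrow> real^3) \<Rightarrow> real) \<Rightarrow> bool" where
  "polyconvex \<omega> \<epsilon> V W \<longleftrightarrow>
     (\<exists>WW :: real^2 \<Rightarrow> (real^2^3) \<times> (real^2^3) \<times> real \<times> real \<times> real \<Rightarrow> real.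
        (AE x in lebesgue_on \<omega>. convex_on M_set (WW x)) \<and>
        (\<forall>\<psi>\<in>V. AE x in lebesgue_on \<omega>.
           (grad \<omega> \<psi> x, grad \<omega> (a3 \<omega> \<psi>) x, curv_args \<omega> \<epsilon> \<psi> x) \<in> M_set \<and>
           W x \<psi> = WW x (grad \<omega> \<psi> x, grad \<omega> (a3 \<omega> \<psi>) x, curv_args \<omega> \<epsilon> \<psi> x)))"

end

theory Submission
  imports Defs
begin

text \<open>
  If the second fundamental form of \<open>\<psi>\<close> is symmetric, the tensor \<open>G\<close> is the Gram matrix \<open>F\<^sup>TF\<close> of
  \<open>F = (\<partial>\<^sub>\<alpha>\<psi> + u \<partial>\<^sub>\<alpha>a\<^sub>3(\<psi>)) \<otimes> g\<^sup>\<alpha>\<close>, which is linear in \<open>(\<nabla>\<psi>, \<nabla>a\<^sub>3(\<psi>))\<close>, and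
  \<open>F \<mapsto> tr ((F\<^sup>TF)\<^sup>s)\<close> is convex for \<open>s \<ge> 1\<close>. Symmetry holds almost everywhere because
  \<open>\<partial>\<^sub>1a\<^sub>3 \<sqdot> \<partial>\<^sub>2\<psi> - \<partial>\<^sub>2a\<^sub>3 \<sqdot> \<partial>\<^sub>1\<psi>\<close> is the distributional divergence of a field with components
  \<open>a\<^sub>3 \<sqdot> \<partial>\<^sub>\<alpha>\<psi> = 0\<close>; the smooth approximations of \<open>a\<^sub>3(\<psi>)\<close> needed to see this are those that
  define its trace.

  For coercivity, \<open>F g\<^sub>\<alpha> = \<partial>\<^sub>\<alpha>\<psi> + u \<partial>\<^sub>\<alpha>a\<^sub>3(\<psi>)\<close> with \<open>g\<^sub>\<alpha>\<close> essentially bounded, and the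
  opposite signs of \<open>u\<close> in the two families of terms control \<open>\<nabla>\<psi>\<close> and \<open>u \<nabla>a\<^sub>3(\<psi>)\<close> separately.
\<close>

section \<open>Convex powers\<close>

text \<open>\<open>weak_partial\<close> is an arbitrary representative, whereas membership in a
  Sobolev space only says that some weak derivative lies in the Lebesgue space. Uniqueness almost
  everywhere, by the fundamental lemma of the calculus of variations, is what lets integrability and
  bounds pass to the representative. Classically \<open>form_b\<close> is symmetric because both
  entries are the normal component of a mixed second derivative of \<psi>; here \<psi> has first
  derivatives only. The bound p \<ge> 2 makes products of first derivatives of \<psi> and of
  \<open>a3 \<omega> \<psi>\<close> integrable, which is enough for a distributional substitute.
  Symmetry matters because \<open>mat_powr\<close> is a definite description, meaningful for
  symmetric matrices only. The curvature bound on \<phi> keeps the tangent vectors independent at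
  every height v with |v| \<le> \<epsilon>, so that the definite description \<open>g_contra\<close>
  denotes the dual basis.\<close>

lemma convex_on_powr_nonneg:
  assumes "p \<ge> 1" shows "convex_on {0..} (\<lambda>x::real. x powr p)"
proof (intro convex_onI)
  fix t x y :: real assume *: "0 < t" "t < 1" "x \<in> {0..}" "y \<in> {0..}"
  \<comment> \<open>The endpoint 0 is treated by hand: as 0 powr p = 0, convexity reduces there to c
    powr p \<le> c for 0 \<le> c \<le> 1.\<close>
  have small: "(c * z) powr p \<le> c * z powr p" if "0 \<le> c" "c \<le> 1" "z \<ge> 0" for c z :: real
  proof -
    have "c powr p \<le> c"
      using that assms powr_mono'[of 1 p c] by (cases "c = 0") auto
    then show ?thesis using that by (simp add: powr_mult mult_right_mono)
  qed
  consider "x = 0" | "y = 0" | "x > 0" "y > 0" using * by fastforce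
  then show "((1 - t) *\<^sub>R x + t *\<^sub>R y) powr p \<le> (1 - t) * x powr p + t * y powr p"
  proof cases
    case 3
    then show ?thesis using convex_onD[OF powr_convex[OF assms], of t x y] * by auto
  qed (use * small[of t y] small[of "1 - t" x] in auto)
qed simp

lemma convex_on_norm_powr:
  assumes "p \<ge> 1" shows "convex_on UNIV (\<lambda>x::'a::real_normed_vector. norm x powr p)"
proof (intro convex_onI)
  fix t :: real and x y :: 'a assume *: "0 < t" "t < 1"
  have "norm ((1 - t) *\<^sub>R x + t *\<^sub>R y) \<le> (1 - t) * norm x + t * norm y"
    using * norm_triangle_ineq[of "(1 - t) *\<^sub>R x" "t *\<^sub>R y"] by simp
  then have "norm ((1 - t) *\<^sub>R x + t *\<^sub>R y) powr p \<le> ((1 - t) * norm x + t * norm y) powr p"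
    using assms by (intro powr_mono2) auto
  also have "\<dots> \<le> (1 - t) * norm x powr p + t * norm y powr p"
    using convex_onD[OF convex_on_powr_nonneg[OF assms], of t "norm x" "norm y"] * by auto
  finally show "norm ((1 - t) *\<^sub>R x + t *\<^sub>R y) powr p \<le> (1 - t) * norm x powr p + t * norm y powr p" .
qed simp

section \<open>Spectral decomposition of symmetric matrices\<close>

lemma symmetric_matrix_inner:
  fixes A :: "real^'n^'n"
  assumes "transpose A = A"
  shows "x \<bullet> (A *v y) = (A *v x) \<bullet> y"
  by (metis assms dot_lmul_matrix vector_transpose_matrix)

text \<open>A maximiser x of the quadratic form on the unit sphere of S is an eigenvector. With the
  residual y = A x - l x, comparing x with x + t y gives 2 t |y|^2 \<le> t^2 c for every real t, and
  the choices t = 1 and t = |y|^2 / c force y = 0. Invariance of S keeps y in S.\<close>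

lemma symmetric_eigenvector_in_subspace:
  fixes A :: "real^'n^'n"
  assumes sym: "transpose A = A" and S: "subspace S" "S \<noteq> {0}"
    and inv: "\<And>x. x \<in> S \<Longrightarrow> A *v x \<in> S"
  obtains x l where "x \<in> S" "norm x = 1" "A *v x = l *\<^sub>R x"
proof -
  define K where "K = S \<inter> sphere 0 1"
  have "compact K" unfolding K_def
    using S(1) closed_subspace compact_sphere by (metis closed_Int_compact)
  moreover have "K \<noteq> {}"
  proof -
    obtain z where "z \<in> S" "z \<noteq> 0" using S subspace_0 by blast
    then have "(1 / norm z) *\<^sub>R z \<in> K" using S(1) by (auto simp: K_def subspace_scale)
    then show ?thesis by blast
  qed
  moreover have "continuous_on K (\<lambda>x. x \<bullet> (A *v x))"
    by (intro continuous_intros)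
  ultimately obtain x where x: "x \<in> K" "\<And>y. y \<in> K \<Longrightarrow> y \<bullet> (A *v y) \<le> x \<bullet> (A *v x)"
    using continuous_attains_sup by metis
  define l where "l = x \<bullet> (A *v x)"
  have le: "y \<bullet> (A *v y) \<le> l * (y \<bullet> y)" if "y \<in> S" for y
  proof (cases "y = 0")
    case False
    then have "(1 / norm y) *\<^sub>R y \<in> K" using S(1) that by (auto simp: K_def subspace_scale)
    from x(2)[OF this] have "(1 / norm y)^2 * (y \<bullet> (A *v y)) \<le> l"
      by (simp add: l_def matrix_vector_mult_scaleR power2_eq_square)
    then show ?thesis using False by (simp add: field_simps dot_square_norm power2_eq_square)
  qed simp
  have xS: "x \<in> S" and x1: "norm x = 1" using x by (auto simp: K_def)
  define y where "y = A *v x - l *\<^sub>R x"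
  have yS: "y \<in> S" unfolding y_def using xS S(1) inv by (simp add: subspace_diff subspace_scale)
  define c where "c = l * (y \<bullet> y) - y \<bullet> (A *v y)"
  have quad: "2 * t * (y \<bullet> y) \<le> t^2 * c" for t :: real
  proof -
    have "(x + t *\<^sub>R y) \<bullet> (A *v (x + t *\<^sub>R y)) \<le> l * ((x + t *\<^sub>R y) \<bullet> (x + t *\<^sub>R y))"
      using xS yS S(1) by (intro le) (simp add: subspace_add subspace_scale)
    moreover have "x \<bullet> (A *v y) = y \<bullet> (A *v x)"
      by (metis sym symmetric_matrix_inner inner_commute)
    moreover have "y \<bullet> (A *v x) = y \<bullet> y + l * (x \<bullet> y)"
      by (simp add: y_def inner_diff inner_commute algebra_simps)
    moreover have "x \<bullet> (A *v x) = l * (x \<bullet> x)" using x1 by (simp add: l_def dot_square_norm)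
    ultimately show ?thesis
      by (simp add: matrix_vector_right_distrib matrix_vector_mult_scaleR inner_add inner_commute
          c_def power2_eq_square algebra_simps)
  qed
  have "y \<bullet> y \<le> 0"
  proof (rule ccontr)
    assume "\<not> y \<bullet> y \<le> 0"
    then have pos: "y \<bullet> y > 0" by (simp only: not_le)
    have "c > 0" using quad[of 1] pos by (simp del: inner_gt_zero_iff)
    then have "(y \<bullet> y) * (y \<bullet> y) \<le> 0"
      using quad[of "(y \<bullet> y) / c"] by (simp add: field_simps power2_eq_square)
    then show False using mult_pos_pos[OF pos pos] by linarith
  qed
  then have "y = 0" by (metis inner_eq_zero_iff inner_ge_zero order_antisym)
  then have "A *v x = l *\<^sub>R x" by (simp add: y_def)
  then show ?thesis using that xS x1 by blast
qed

text \<open>Induction on the dimension: the part of S orthogonal to one eigenvector is again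
  invariant, because x \<bullet> A y = l (x \<bullet> y) by symmetry.\<close>

lemma symmetric_eigenbasis_subspace:
  fixes A :: "real^'n^'n"
  assumes sym: "transpose A = A" and "subspace S" and "\<And>x. x \<in> S \<Longrightarrow> A *v x \<in> S"
  shows "\<exists>B. B \<subseteq> S \<and> card B = dim S \<and> pairwise orthogonal B \<and>
             (\<forall>b\<in>B. norm b = 1 \<and> (\<exists>l. A *v b = l *\<^sub>R b))"
  using assms(2,3)
proof (induction "dim S" arbitrary: S)
  case 0
  then show ?case by (intro exI[of _ "{}"]) (auto simp: pairwise_def)
next
  case (Suc n)
  have "S \<noteq> {0}" using Suc(2) by auto
  then obtain x l where x: "x \<in> S" "norm x = 1" "A *v x = l *\<^sub>R x"
    using symmetric_eigenvector_in_subspace[OF sym Suc(3)] Suc(4) by blast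
  define S' where "S' = {y \<in> S. \<forall>z\<in>{x}. orthogonal z y}"
  have "S' = {y \<in> S. \<forall>z\<in>span {x}. orthogonal z y}"
    by (auto simp: S'_def span_singleton orthogonal_def)
  then have "dim S' + dim (span {x}) = dim S"
    using dim_subspace_orthogonal_to_vectors[of "span {x}" S] x Suc(3)
    by (simp add: span_minimal del: dim_span dim_singleton)
  moreover have "x \<noteq> 0" using x by auto
  ultimately have n: "n = dim S'" using Suc(2) by simp
  have sub: "subspace S'"
    using Suc(3) by (auto simp: S'_def subspace_def orthogonal_def inner_add_right)
  have "A *v y \<in> S'" if "y \<in> S'" for y
  proof -
    have "x \<bullet> (A *v y) = l * (x \<bullet> y)"
      by (simp add: symmetric_matrix_inner[OF sym] x)
    then show ?thesis using that Suc(4) by (auto simp: S'_def orthogonal_def)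
  qed
  then obtain B where B: "B \<subseteq> S'" "card B = dim S'" "pairwise orthogonal B"
      "\<forall>b\<in>B. norm b = 1 \<and> (\<exists>l. A *v b = l *\<^sub>R b)"
    using Suc(1)[OF n sub] by blast
  have "x \<notin> B" using B(1) x(2) by (auto simp: S'_def orthogonal_def)
  moreover have "finite B"
  proof -
    have "0 \<notin> B" using B(4) by auto
    then show ?thesis using pairwise_orthogonal_imp_finite B(3) by blast
  qed
  ultimately have "card (insert x B) = dim S" using B(2) n Suc(2) by simp
  moreover have "pairwise orthogonal (insert x B)"
    using B(1,3) by (auto simp: pairwise_insert S'_def orthogonal_commute)
  ultimately show ?case using B x by (intro exI[of _ "insert x B"]) (auto simp: S'_def)
qed

text \<open>This is verbatim the condition inside \<open>mat_powr\<close>, which can thus be folded.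
  The index type is that of the coordinates, so such a family is automatically a basis.\<close>

definition orthonormal :: "('n \<Rightarrow> real^'n) \<Rightarrow> bool" where
  "orthonormal e \<longleftrightarrow> (\<forall>i j. e i \<bullet> e j = (if i = j then 1 else 0))"

lemma orthonormal_expand:
  fixes e :: "'n::finite \<Rightarrow> real^'n"
  assumes "orthonormal e"
  shows "(\<Sum>i\<in>UNIV. (e i \<bullet> x) *\<^sub>R e i) = x"
proof -
  have inj: "inj e"
    using assms unfolding orthonormal_def by (metis injI zero_neq_one)
  have ne: "norm (e i) = 1" for i using assms by (simp add: orthonormal_def norm_eq_1)
  have orth: "pairwise orthogonal (range e)"
    using assms by (auto simp: pairwise_def orthogonal_def orthonormal_def)
  moreover have "0 \<notin> range e" using ne by (metis imageE norm_zero zero_neq_one)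
  ultimately have ind: "independent (range e)" by (rule pairwise_orthogonal_independent)
  have "span (range e) = UNIV"
  proof -
    have "card (range e) = CARD('n)" using inj by (rule card_image)
    then show ?thesis using ind
      by (metis dim_UNIV card_ge_dim_independent DIM_cart DIM_real mult.right_neutral dim_eq_card
          dim_subset_UNIV order_refl span_superset subset_UNIV top.extremum_unique)
  qed
  then have "(\<Sum>b\<in>range e. (b \<bullet> x) *\<^sub>R b) = x"
    using orthonormal_basis_expand[OF orth, of x] ne by (auto simp: inner_commute)
  then show ?thesis using inj by (simp add: sum.reindex)
qed

lemma orthonormal_parseval:
  fixes e :: "'n::finite \<Rightarrow> real^'n"
  assumes "orthonormal e"
  shows "(\<Sum>i\<in>UNIV. (e i \<bullet> x)\<^sup>2) = x \<bullet> x"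
proof -
  have "x \<bullet> x = (\<Sum>i\<in>UNIV. (e i \<bullet> x) *\<^sub>R e i) \<bullet> x" by (simp add: orthonormal_expand[OF assms])
  then show ?thesis by (simp add: inner_sum_left power2_eq_square)
qed

section \<open>Matrices written as sums of tensors\<close>

lemma tensor_mult_vector: "tensor u w *v x = (w \<bullet> x) *\<^sub>R u"
  by (simp add: tensor_def vec_eq_iff matrix_vector_mult_def inner_vec_def sum_distrib_left mult_ac)

lemma sum_matrix_mult_vector:
  "finite S \<Longrightarrow> (\<Sum>i\<in>S. M i) *v x = (\<Sum>i\<in>S. M i *v (x :: real^'n))"
  by (induction S rule: finite_induct) (auto simp: matrix_vector_mult_add_rdistrib)

lemma scaleR_matrix_mult_vector: "(c *\<^sub>R M) *v x = c *\<^sub>R (M *v (x :: real^'n))"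
  by (simp add: scaleR_matrix_vector_assoc)

lemma spectral_sum_mult_vector:
  fixes e :: "'n::finite \<Rightarrow> real^'n"
  shows "(\<Sum>i\<in>UNIV. l i *\<^sub>R tensor (e i) (e i)) *v x = (\<Sum>i\<in>UNIV. (l i * (e i \<bullet> x)) *\<^sub>R e i)"
  by (simp add: sum_matrix_mult_vector scaleR_matrix_mult_vector tensor_mult_vector)

lemma spectral_sum_eigenvector:
  fixes e :: "'n::finite \<Rightarrow> real^'n"
  assumes "orthonormal e"
  shows "(\<Sum>i\<in>UNIV. l i *\<^sub>R tensor (e i) (e i)) *v e j = l j *\<^sub>R e j"
proof -
  have "(l i * (e i \<bullet> e j)) *\<^sub>R e i = (if i = j then l j *\<^sub>R e j else 0)" for i
    using assms by (simp add: orthonormal_def)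
  then show ?thesis by (simp add: spectral_sum_mult_vector)
qed

lemma orthonormal_matrix_eqI:
  fixes e :: "'n::finite \<Rightarrow> real^'n" and A B :: "real^'n^'n"
  assumes e: "orthonormal e" and "\<And>i. A *v e i = B *v e i"
  shows "A = B"
proof -
  have "A *v x = B *v x" for x
  proof -
    have "A *v (\<Sum>i\<in>UNIV. (e i \<bullet> x) *\<^sub>R e i) = B *v (\<Sum>i\<in>UNIV. (e i \<bullet> x) *\<^sub>R e i)"
      by (simp add: vec.sum matrix_vector_mult_scaleR assms(2))
    then show ?thesis by (simp add: orthonormal_expand[OF e])
  qed
  then show ?thesis by (simp add: matrix_eq)
qed

lemma symmetric_spectral_decomposition:
  fixes A :: "real^'n^'n"
  assumes "transpose A = A"
  obtains e l where "orthonormal e" "A = (\<Sum>i\<in>UNIV. l i *\<^sub>R tensor (e i) (e i))"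
proof -
  obtain B where B: "card B = CARD('n)" "pairwise orthogonal B"
      "\<forall>b\<in>B. norm b = 1 \<and> (\<exists>l. A *v b = l *\<^sub>R b)"
    using symmetric_eigenbasis_subspace[OF assms, of UNIV] by auto
  have "finite B" using B(1) by (metis card.infinite zero_less_card_finite not_less_zero)
  then obtain e where e: "bij_betw e (UNIV :: 'n set) B"
    using B(1) by (metis finite_same_card_bij finite_class.finite_UNIV)
  have o: "orthonormal e" unfolding orthonormal_def
  proof (intro allI)
    fix i j
    have "e i \<in> B" "e j \<in> B" and "i \<noteq> j \<Longrightarrow> e i \<noteq> e j"
      using e by (auto simp: bij_betw_def inj_on_def)
    then show "e i \<bullet> e j = (if i = j then 1 else 0)"
      using B by (auto simp: pairwise_def orthogonal_def norm_eq_1)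
  qed
  have "\<forall>i. \<exists>l. A *v e i = l *\<^sub>R e i" using B(3) e by (auto simp: bij_betw_def)
  then obtain l where l: "\<And>i. A *v e i = l i *\<^sub>R e i" by metis
  have "A = (\<Sum>i\<in>UNIV. l i *\<^sub>R tensor (e i) (e i))"
    by (rule orthonormal_matrix_eqI[OF o]) (simp add: l spectral_sum_eigenvector[OF o])
  then show ?thesis using that o by blast
qed

text \<open>Pairing A e_j = l_j e_j with d_k gives m_k (d_k \<bullet> e_j) = l_j (d_k \<bullet>
  e_j). Hence d_k \<bullet> e_j vanishes unless m_k = l_j, and the equation survives when both
  eigenvalues are raised to the power s. This makes the definite description in
  \<open>mat_powr\<close> well defined.\<close>

lemma spectral_sum_powr_unique:
  fixes d e :: "'n::finite \<Rightarrow> real^'n"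
  assumes d: "orthonormal d" and e: "orthonormal e"
    and eq: "(\<Sum>i\<in>UNIV. m i *\<^sub>R tensor (d i) (d i)) = (\<Sum>i\<in>UNIV. l i *\<^sub>R tensor (e i) (e i))"
  shows "(\<Sum>i\<in>UNIV. (m i powr s) *\<^sub>R tensor (d i) (d i)) = (\<Sum>i\<in>UNIV. (l i powr s) *\<^sub>R tensor (e i) (e i))"
    (is "?P = ?Q")
proof (rule orthonormal_matrix_eqI[OF e])
  fix j
  have Ae: "(\<Sum>i\<in>UNIV. (m i * (d i \<bullet> e j)) *\<^sub>R d i) = l j *\<^sub>R e j"
    using spectral_sum_eigenvector[OF e, of l j] by (simp add: eq[symmetric] spectral_sum_mult_vector)
  have "d k \<bullet> (\<Sum>i\<in>UNIV. (m i * (d i \<bullet> e j)) *\<^sub>R d i) = m k * (d k \<bullet> e j)" for k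
  proof -
    have "(m i * (d i \<bullet> e j)) * (d k \<bullet> d i) = (if k = i then m k * (d k \<bullet> e j) else 0)" for i
      using d by (simp add: orthonormal_def)
    then show ?thesis by (simp add: inner_sum_right)
  qed
  then have mult: "m k * (d k \<bullet> e j) = l j * (d k \<bullet> e j)" for k
    unfolding Ae inner_scaleR_right by (rule sym)
  have powr: "m k powr s * (d k \<bullet> e j) = l j powr s * (d k \<bullet> e j)" for k
    using mult[of k] by auto
  have "?P *v e j = (\<Sum>k\<in>UNIV. (l j powr s * (d k \<bullet> e j)) *\<^sub>R d k)"
    by (simp only: spectral_sum_mult_vector powr)
  also have "\<dots> = l j powr s *\<^sub>R (\<Sum>k\<in>UNIV. (d k \<bullet> e j) *\<^sub>R d k)"
    by (simp add: scaleR_sum_right)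
  also have "\<dots> = ?Q *v e j"
    by (simp only: orthonormal_expand[OF d] spectral_sum_eigenvector[OF e])
  finally show "?P *v e j = ?Q *v e j" .
qed

lemma mat_powr_spectral:
  fixes e :: "'n::finite \<Rightarrow> real^'n"
  assumes e: "orthonormal e" and A: "A = (\<Sum>i\<in>UNIV. l i *\<^sub>R tensor (e i) (e i))"
  shows "mat_powr A s = (\<Sum>i\<in>UNIV. (l i powr s) *\<^sub>R tensor (e i) (e i))"
  unfolding mat_powr_def orthonormal_def[symmetric]
proof (rule the_equality)
  show "\<exists>d m. orthonormal d \<and> A = (\<Sum>i\<in>UNIV. m i *\<^sub>R tensor (d i) (d i)) \<and>
        (\<Sum>i\<in>UNIV. (l i powr s) *\<^sub>R tensor (e i) (e i)) = (\<Sum>i\<in>UNIV. (m i powr s) *\<^sub>R tensor (d i) (d i))"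
    using assms by blast
next
  fix P assume "\<exists>d m. orthonormal d \<and> A = (\<Sum>i\<in>UNIV. m i *\<^sub>R tensor (d i) (d i)) \<and>
        P = (\<Sum>i\<in>UNIV. (m i powr s) *\<^sub>R tensor (d i) (d i))"
  then obtain d m where d: "orthonormal d" "A = (\<Sum>i\<in>UNIV. m i *\<^sub>R tensor (d i) (d i))"
      "P = (\<Sum>i\<in>UNIV. (m i powr s) *\<^sub>R tensor (d i) (d i))"
    by (elim exE conjE)
  show "P = (\<Sum>i\<in>UNIV. (l i powr s) *\<^sub>R tensor (e i) (e i))"
    unfolding d(3) by (rule spectral_sum_powr_unique[OF d(1) e trans[OF d(2)[symmetric] A]])
qed

lemma trace_mat_powr_spectral:
  fixes e :: "'n::finite \<Rightarrow> real^'n"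
  assumes e: "orthonormal e" and A: "A = (\<Sum>i\<in>UNIV. l i *\<^sub>R tensor (e i) (e i))"
  shows "trace (mat_powr A s) = (\<Sum>i\<in>UNIV. l i powr s)"
proof -
  have "trace (\<Sum>i\<in>S. f i) = (\<Sum>i\<in>S. trace (f i))" for S and f :: "'n \<Rightarrow> real^'n^'n"
    unfolding trace_def sum_component by (rule sum.swap)
  moreover have "trace (c *\<^sub>R tensor (e i) (e i)) = c" for c i
  proof -
    have "trace (c *\<^sub>R tensor (e i) (e i)) = c * (e i \<bullet> e i)"
      by (simp add: trace_def tensor_def inner_vec_def sum_distrib_left)
    then show ?thesis using e by (simp add: orthonormal_def)
  qed
  ultimately show ?thesis by (simp add: mat_powr_spectral[OF assms])
qed

text \<open>The trace is a sum of values of real \<open>powr\<close>, which is never negative,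
  whatever the sign of its base.\<close>

lemma trace_mat_powr_nonneg:
  fixes A :: "real^'n^'n"
  assumes "transpose A = A"
  shows "trace (mat_powr A s) \<ge> 0"
proof -
  obtain e l where el: "orthonormal e" "A = (\<Sum>i\<in>UNIV. l i *\<^sub>R tensor (e i) (e i))"
    using symmetric_spectral_decomposition[OF assms] .
  show ?thesis by (simp add: trace_mat_powr_spectral[OF el] sum_nonneg)
qed

section \<open>Convexity of the trace of powers\<close>

lemma spectral_quadratic_form:
  fixes e :: "'n::finite \<Rightarrow> real^'n"
  assumes A: "A = (\<Sum>i\<in>UNIV. l i *\<^sub>R tensor (e i) (e i))"
  shows "x \<bullet> (A *v x) = (\<Sum>i\<in>UNIV. (e i \<bullet> x)\<^sup>2 * l i)"
  unfolding A spectral_sum_mult_vector inner_sum_right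
  by (intro sum.cong refl) (simp add: power2_eq_square inner_commute)

lemma spectral_quadratic_form_eigenvector:
  fixes e :: "'n::finite \<Rightarrow> real^'n"
  assumes e: "orthonormal e" and A: "A = (\<Sum>i\<in>UNIV. l i *\<^sub>R tensor (e i) (e i))"
  shows "e i \<bullet> (A *v e i) = l i"
  unfolding A spectral_sum_eigenvector[OF e] using e by (simp add: orthonormal_def)

text \<open>By Parseval the numbers (e_i \<bullet> x)^2 are weights of total mass 1, and x \<bullet>
  A x is the corresponding mean of the eigenvalues; Jensen's inequality applies to t powr s.\<close>

lemma spectral_powr_jensen:
  fixes e :: "'n::finite \<Rightarrow> real^'n"
  assumes e: "orthonormal e" and A: "A = (\<Sum>i\<in>UNIV. l i *\<^sub>R tensor (e i) (e i))"
    and l: "\<And>i. l i \<ge> 0" and s: "s \<ge> 1" and x: "norm x = 1"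
  shows "(x \<bullet> (A *v x)) powr s \<le> (\<Sum>i\<in>UNIV. (e i \<bullet> x)\<^sup>2 * l i powr s)"
proof -
  have "(\<Sum>i\<in>UNIV. (e i \<bullet> x)\<^sup>2) = 1"
    using x by (simp add: orthonormal_parseval[OF e] dot_square_norm)
  then show ?thesis
    using convex_on_sum[OF _ _ convex_on_powr_nonneg[OF s], of UNIV "\<lambda>i. (e i \<bullet> x)\<^sup>2" l] l
    by (simp add: spectral_quadratic_form[OF A])
qed

lemma psd_spectral_decomposition:
  fixes A :: "real^'n^'n"
  assumes "transpose A = A" and "\<And>x. x \<bullet> (A *v x) \<ge> 0"
  obtains e l where "orthonormal e" "A = (\<Sum>i\<in>UNIV. l i *\<^sub>R tensor (e i) (e i))" "\<And>i. l i \<ge> 0"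
proof -
  obtain e l where el: "orthonormal e" "A = (\<Sum>i\<in>UNIV. l i *\<^sub>R tensor (e i) (e i))"
    using symmetric_spectral_decomposition[OF assms(1)] .
  have "l i \<ge> 0" for i using spectral_quadratic_form_eigenvector[OF el, of i] assms(2) by metis
  then show ?thesis using that el by blast
qed

text \<open>Jensen's inequality with each weight (e_i \<bullet> x)^2 estimated by 1. This
  single-vector bound serves coercivity, the version for a whole basis serves convexity.\<close>

lemma quadratic_form_powr_le_trace:
  fixes A :: "real^'n^'n"
  assumes A: "transpose A = A" "\<And>x. x \<bullet> (A *v x) \<ge> 0" and "s \<ge> 1" and x: "norm x = 1"
  shows "(x \<bullet> (A *v x)) powr s \<le> trace (mat_powr A s)"
proof -
  obtain e l where el: "orthonormal e" "A = (\<Sum>i\<in>UNIV. l i *\<^sub>R tensor (e i) (e i))" "\<And>i. l i \<ge> 0"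
    using psd_spectral_decomposition[OF A] by blast
  have "norm (e i) = 1" for i using el(1) by (simp add: orthonormal_def norm_eq_1)
  then have "\<bar>e i \<bullet> x\<bar> \<le> 1" for i
    using x Cauchy_Schwarz_ineq2[of "e i" x] by simp
  then have "(e i \<bullet> x)\<^sup>2 * l i powr s \<le> l i powr s" for i
    by (intro mult_left_le_one_le) (auto simp: abs_square_le_1)
  then have "(\<Sum>i\<in>UNIV. (e i \<bullet> x)\<^sup>2 * l i powr s) \<le> trace (mat_powr A s)"
    by (simp add: trace_mat_powr_spectral[OF el(1,2)] sum_mono)
  then show ?thesis
    using spectral_powr_jensen[OF el(1,2,3) assms(3) x] by linarith
qed

text \<open>Peierls' inequality: the weights (e_i \<bullet> d_j)^2 form a doubly stochastic matrix.
  Jensen uses that they sum to 1 over i; summing the result over j uses the same for the other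
  index.\<close>

lemma sum_quadratic_form_powr_le_trace:
  fixes A :: "real^'n^'n"
  assumes A: "transpose A = A" "\<And>x. x \<bullet> (A *v x) \<ge> 0" and "s \<ge> 1" and d: "orthonormal d"
  shows "(\<Sum>j\<in>UNIV. (d j \<bullet> (A *v d j)) powr s) \<le> trace (mat_powr A s)"
proof -
  obtain e l where el: "orthonormal e" "A = (\<Sum>i\<in>UNIV. l i *\<^sub>R tensor (e i) (e i))" "\<And>i. l i \<ge> 0"
    using psd_spectral_decomposition[OF A] by blast
  have "(\<Sum>j\<in>UNIV. (d j \<bullet> (A *v d j)) powr s) \<le> (\<Sum>j\<in>UNIV. \<Sum>i\<in>UNIV. (e i \<bullet> d j)\<^sup>2 * l i powr s)"
    using d by (intro sum_mono spectral_powr_jensen[OF el(1,2,3) assms(3)]) (simp add: orthonormal_def norm_eq_1)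
  also have "\<dots> = (\<Sum>i\<in>UNIV. (\<Sum>j\<in>UNIV. (d j \<bullet> e i)\<^sup>2) * l i powr s)"
    by (subst sum.swap) (simp add: sum_distrib_right inner_commute)
  also have "\<dots> = trace (mat_powr A s)"
    using el(1) by (simp add: orthonormal_parseval[OF d] trace_mat_powr_spectral[OF el(1,2)] orthonormal_def)
  finally show ?thesis .
qed

section \<open>Gram matrices\<close>

lemma gram_quadratic_form:
  fixes F :: "real^'n^'m"
  shows "x \<bullet> ((transpose F ** F) *v x) = (norm (F *v x))\<^sup>2"
proof -
  have "x \<bullet> (transpose F *v (F *v x)) = (F *v x) \<bullet> (F *v x)"
    by (metis dot_lmul_matrix inner_commute vector_transpose_matrix transpose_transpose)
  then show ?thesis by (simp add: matrix_vector_mul_assoc dot_square_norm)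
qed

lemma transpose_gram: "transpose (transpose F ** F) = transpose F ** (F :: real^'n^'m)"
  by (simp add: matrix_transpose_mul)

lemma norm_powr_le_trace_gram:
  fixes F :: "real^'n^'m"
  assumes "s \<ge> 1"
  shows "norm (F *v x) powr (2 * s) \<le> norm x powr (2 * s) * trace (mat_powr (transpose F ** F) s)"
proof (cases "x = 0")
  case False
  define y where "y = (1 / norm x) *\<^sub>R x"
  have "((norm (F *v y))\<^sup>2) powr s \<le> trace (mat_powr (transpose F ** F) s)"
    using quadratic_form_powr_le_trace[of "transpose F ** F" s y] False assms
    by (simp add: gram_quadratic_form transpose_gram y_def)
  then have "norm (F *v y) powr (2 * s) \<le> trace (mat_powr (transpose F ** F) s)"
    by (simp add: powr_powr[symmetric])
  moreover have "F *v x = norm x *\<^sub>R (F *v y)"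
    using False by (simp add: y_def matrix_vector_mult_scaleR)
  ultimately show ?thesis by (simp add: powr_mult mult_left_mono)
qed (use assms in simp)

text \<open>
  By Jensen's inequality the trace of \<open>(F\<^sup>TF)\<^sup>s\<close> is the maximum over all orthonormal bases \<open>d\<close> of the sums
  of \<open>|F d\<^sub>j|\<^sup>2\<^sup>s\<close>, attained at an eigenbasis; each of these sums is convex in \<open>F\<close>.
\<close>
lemma convex_on_trace_gram_powr:
  assumes "s \<ge> 1"
  shows "convex_on UNIV (\<lambda>F :: real^'n^'m. trace (mat_powr (transpose F ** F) s))"
proof (intro convex_onI)
  fix t :: real and X Y :: "real^'n^'m" assume t: "0 < t" "t < 1"
  define Z where "Z = (1 - t) *\<^sub>R X + t *\<^sub>R Y"
  \<comment> \<open>The basis diagonalises the Gram matrix of the combination Z, in general not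
    those of X and Y. So the trace is computed exactly for Z, while for X and Y the sums over the
    same basis are bounded above by the traces.\<close>
  obtain d l where d: "orthonormal d" "transpose Z ** Z = (\<Sum>i\<in>UNIV. l i *\<^sub>R tensor (d i) (d i))"
    using symmetric_spectral_decomposition[OF transpose_gram] .
  have "trace (mat_powr (transpose Z ** Z) s) = (\<Sum>j\<in>UNIV. (d j \<bullet> ((transpose Z ** Z) *v d j)) powr s)"
    by (simp only: trace_mat_powr_spectral[OF d] spectral_quadratic_form_eigenvector[OF d])
  also have "\<dots> = (\<Sum>j\<in>UNIV. norm (Z *v d j) powr (2 * s))"
    by (simp add: gram_quadratic_form powr_powr[symmetric])
  also have "\<dots> \<le> (\<Sum>j\<in>UNIV. (1 - t) * norm (X *v d j) powr (2 * s) + t * norm (Y *v d j) powr (2 * s))"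
  proof (rule sum_mono)
    fix j
    have "Z *v d j = (1 - t) *\<^sub>R (X *v d j) + t *\<^sub>R (Y *v d j)"
      by (simp add: Z_def matrix_vector_mult_add_rdistrib scaleR_matrix_mult_vector)
    then show "norm (Z *v d j) powr (2 * s) \<le> (1 - t) * norm (X *v d j) powr (2 * s) + t * norm (Y *v d j) powr (2 * s)"
      using convex_onD[OF convex_on_norm_powr[of "2 * s"], of t "X *v d j" "Y *v d j"] t assms by simp
  qed
  also have "\<dots> = (1 - t) * (\<Sum>j\<in>UNIV. norm (X *v d j) powr (2 * s)) + t * (\<Sum>j\<in>UNIV. norm (Y *v d j) powr (2 * s))"
    by (simp add: sum.distrib sum_distrib_left)
  also have "\<dots> \<le> (1 - t) * trace (mat_powr (transpose X ** X) s) + t * trace (mat_powr (transpose Y ** Y) s)"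
  proof -
    have "(\<Sum>j\<in>UNIV. norm (F *v d j) powr (2 * s)) \<le> trace (mat_powr (transpose F ** F) s)" for F :: "real^'n^'m"
      using sum_quadratic_form_powr_le_trace[OF transpose_gram _ assms d(1), of F]
      by (simp add: gram_quadratic_form powr_powr[symmetric])
    then show ?thesis using t by (intro add_mono mult_left_mono) auto
  qed
  finally show "trace (mat_powr (transpose ((1 - t) *\<^sub>R X + t *\<^sub>R Y) ** ((1 - t) *\<^sub>R X + t *\<^sub>R Y)) s)
     \<le> (1 - t) * trace (mat_powr (transpose X ** X) s) + t * trace (mat_powr (transpose Y ** Y) s)"
    by (simp add: Z_def)
qed simp

section \<open>Smooth functions\<close>

lemma partial_deriv_eq:
  "(f has_derivative f') (at x) \<Longrightarrow> partial_deriv \<alpha> f x = f' (axis \<alpha> 1)"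
  unfolding partial_deriv_def by (metis frechet_derivative_at)

lemma C_k_SucD: "C_k (Suc k) f \<Longrightarrow> C_k k f"
proof (induction k arbitrary: f)
  case 0
  then show ?case
    by (auto intro!: differentiable_imp_continuous_on simp: differentiable_on_def differentiable_at_withinI)
qed auto

lemma C_k_const: "C_k k (\<lambda>x. c)"
proof (induction k arbitrary: c)
  case (Suc k)
  have "partial_deriv \<alpha> (\<lambda>x. c) = (\<lambda>x. 0)" for \<alpha>
    by (rule ext) (simp add: partial_deriv_eq[OF has_derivative_const])
  then show ?case using Suc by simp
qed simp

lemma C_k_add: "C_k k f \<Longrightarrow> C_k k g \<Longrightarrow> C_k k (\<lambda>x. f x + g x)"
proof (induction k arbitrary: f g)
  case (Suc k)
  then have f: "\<And>x. f differentiable (at x)" and g: "\<And>x. g differentiable (at x)" by auto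
  have "partial_deriv \<alpha> (\<lambda>x. f x + g x) = (\<lambda>x. partial_deriv \<alpha> f x + partial_deriv \<alpha> g x)" for \<alpha>
    by (rule ext, unfold partial_deriv_def[of _ f] partial_deriv_def[of _ g], rule partial_deriv_eq)
       (intro has_derivative_add f[unfolded frechet_derivative_works] g[unfolded frechet_derivative_works])
  then show ?case using Suc f g by auto
qed (auto intro: continuous_intros)

lemma partial_deriv_mult:
  fixes f g :: "real^2 \<Rightarrow> real"
  assumes "f differentiable (at x)" "g differentiable (at x)"
  shows "partial_deriv \<alpha> (\<lambda>x. f x * g x) x = f x * partial_deriv \<alpha> g x + partial_deriv \<alpha> f x * g x"
  unfolding partial_deriv_def[of _ f] partial_deriv_def[of _ g]
  by (rule partial_deriv_eq) (intro has_derivative_mult assms[unfolded frechet_derivative_works])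

lemma C_k_mult:
  fixes f g :: "real^2 \<Rightarrow> real"
  shows "C_k k f \<Longrightarrow> C_k k g \<Longrightarrow> C_k k (\<lambda>x. f x * g x)"
proof (induction k arbitrary: f g)
  case (Suc k)
  then have f: "\<And>x. f differentiable (at x)" and g: "\<And>x. g differentiable (at x)" by auto
  have "partial_deriv \<alpha> (\<lambda>x. f x * g x) = (\<lambda>x. f x * partial_deriv \<alpha> g x + partial_deriv \<alpha> f x * g x)" for \<alpha>
    using f g by (intro ext partial_deriv_mult)
  moreover have "C_k k (\<lambda>x. f x * partial_deriv \<alpha> g x + partial_deriv \<alpha> f x * g x)" for \<alpha>
    using Suc(2,3)[THEN C_k_SucD] Suc by (intro C_k_add Suc(1)) auto
  ultimately show ?case using f g by auto
qed (auto intro: continuous_intros)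

lemma partial_deriv_component:
  fixes f :: "real^2 \<Rightarrow> real^'n"
  assumes "f differentiable (at x)"
  shows "partial_deriv \<alpha> (\<lambda>x. f x $ k) x = partial_deriv \<alpha> f x $ k"
  unfolding partial_deriv_def[of _ f]
  by (rule partial_deriv_eq)
     (intro bounded_linear.has_derivative[OF bounded_linear_vec_nth] assms[unfolded frechet_derivative_works])

lemma C_k_component:
  fixes f :: "real^2 \<Rightarrow> real^'n"
  shows "C_k k f \<Longrightarrow> C_k k (\<lambda>x. f x $ i)"
proof (induction k arbitrary: f)
  case (Suc k)
  then have f: "\<And>x. f differentiable (at x)" by auto
  have "partial_deriv \<alpha> (\<lambda>x. f x $ i) = (\<lambda>x. partial_deriv \<alpha> f x $ i)" for \<alpha>
    using f by (intro ext partial_deriv_component)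
  moreover have "(\<lambda>x. f x $ i) differentiable at x" for x
    using f[of x] unfolding differentiable_def
    by (blast intro: bounded_linear.has_derivative[OF bounded_linear_vec_nth])
  ultimately show ?case using Suc by auto
qed (auto intro: continuous_intros)

lemma smooth_const: "smooth (\<lambda>x. c)"
  by (simp add: smooth_def C_k_const)

lemma smooth_mult: "smooth f \<Longrightarrow> smooth g \<Longrightarrow> smooth (\<lambda>x. f x * g x :: real)"
  by (simp add: smooth_def C_k_mult)

lemma smooth_component: "smooth f \<Longrightarrow> smooth (\<lambda>x. f x $ i :: real)"
  by (simp add: smooth_def C_k_component)

lemma smooth_partial_deriv: "smooth f \<Longrightarrow> smooth (partial_deriv \<alpha> f)"
  unfolding smooth_def by (metis C_k.simps(2))

lemma smooth_differentiable: "smooth f \<Longrightarrow> f differentiable (at x)"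
  unfolding smooth_def by (metis C_k.simps(2))

lemma smooth_continuous_on: "smooth f \<Longrightarrow> continuous_on S f"
  unfolding smooth_def by (metis C_k.simps(1) continuous_on_subset subset_UNIV)

lemma smooth_prod:
  "finite I \<Longrightarrow> (\<And>i. i \<in> I \<Longrightarrow> smooth (f i)) \<Longrightarrow> smooth (\<lambda>x. \<Prod>i\<in>I. f i x :: real)"
  by (induction I rule: finite_induct) (auto simp: smooth_const smooth_mult)

text \<open>The flat function exp(-1/t), divided by t^j. Carrying the power along makes the family
  closed under differentiation up to linear combinations, so that all derivatives are reached by an
  induction in which j varies.\<close>

definition flat_exp :: "nat \<Rightarrow> real \<Rightarrow> real" where
  "flat_exp j t = (if t > 0 then exp (- (1 / t)) / t ^ j else 0)"

lemma power_div_fact_le_exp: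
  assumes "x \<ge> (0::real)" shows "x ^ n / fact n \<le> exp x"
proof -
  have "sum (\<lambda>k. x ^ k /\<^sub>R fact k) {n} \<le> (\<Sum>k. x ^ k /\<^sub>R fact k)"
    using assms by (intro sum_le_suminf summable_exp_generic) auto
  then show ?thesis by (simp add: exp_def divide_inverse mult.commute)
qed

text \<open>The term of degree j + 2 of the series of exp(1/t) bounds exp(-1/t) by a multiple of
  t^(j+2). Two powers more than the denominator make the difference quotient at 0 tend to 0.\<close>

lemma flat_exp_bound: "\<bar>flat_exp j t\<bar> \<le> fact (j + 2) * t\<^sup>2"
proof (cases "t > 0")
  case True
  define m where "m = j + 2"
  have "(1 / t) ^ m / fact m \<le> exp (1 / t)"
    using True by (intro power_div_fact_le_exp) auto
  then have "exp (- (1 / t)) \<le> fact m * t ^ m"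
    using True by (simp add: exp_minus field_simps)
  then have "exp (- (1 / t)) / t ^ j \<le> fact m * t\<^sup>2"
    using True by (simp add: m_def power_add pos_divide_le_eq power2_eq_square mult_ac del: fact_Suc)
  then have "exp (- (1 / t)) / t ^ j \<le> fact (j + 2) * t\<^sup>2" by (simp only: m_def)
  then show ?thesis using True by (simp add: flat_exp_def)
qed (simp add: flat_exp_def)

lemma flat_exp_has_derivative:
  "(flat_exp j has_real_derivative flat_exp (j + 2) t - j * flat_exp (j + 1) t) (at t)"
proof -
  consider "t > 0" | "t < 0" | "t = 0" by linarith
  then show ?thesis
  proof cases
    case 1
    have "((\<lambda>t. exp (- (1 / t)) / t ^ j) has_real_derivative
        (exp (- (1 / t)) * (1 / t\<^sup>2) * t ^ j - exp (- (1 / t)) * (real j * t ^ (j - 1))) / (t ^ j * t ^ j)) (at t)"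
      using 1 by (auto intro!: derivative_eq_intros simp: power2_eq_square)
    moreover have "(exp (- (1 / t)) * (1 / t\<^sup>2) * t ^ j - exp (- (1 / t)) * (real j * t ^ (j - 1))) / (t ^ j * t ^ j) =
        flat_exp (j + 2) t - j * flat_exp (j + 1) t"
      \<comment> \<open>The exponent j - 1 is truncated at j = 0, where the factor j removes the
        term; hence the case distinction.\<close>
      using 1 by (cases j) (auto simp: flat_exp_def field_simps power2_eq_square)
    moreover have "eventually (\<lambda>s. s \<in> {0<..}) (nhds t)" using 1 by (intro eventually_nhds_in_open) auto
    then have "eventually (\<lambda>s. flat_exp j s = exp (- (1 / s)) / s ^ j) (nhds t)"
      by eventually_elim (simp add: flat_exp_def)
    ultimately show ?thesis by (simp add: DERIV_cong_ev)
  next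
    case 2
    have "eventually (\<lambda>s. s \<in> {..<0}) (nhds t)" using 2 by (intro eventually_nhds_in_open) auto
    then have "eventually (\<lambda>s. flat_exp j s = 0) (nhds t)"
      by eventually_elim (simp add: flat_exp_def)
    then show ?thesis using 2 by (simp add: DERIV_cong_ev flat_exp_def)
  next
    case 3
    have "((\<lambda>h. flat_exp j h / h) \<longlongrightarrow> 0) (at 0)"
    proof (rule Lim_null_comparison)
      have "norm (flat_exp j h / h) \<le> fact (j + 2) * \<bar>h\<bar>" if "h \<noteq> 0" for h
        using flat_exp_bound[of j h] that
        by (simp add: abs_divide pos_divide_le_eq power2_eq_square mult.assoc del: fact_Suc add_2_eq_Suc')
      then show "eventually (\<lambda>h. norm (flat_exp j h / h) \<le> fact (j + 2) * \<bar>h\<bar>) (at 0)"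
        by (simp add: eventually_at_filter)
      show "((\<lambda>h. fact (j + 2) * \<bar>h\<bar>) \<longlongrightarrow> 0) (at (0::real))"
        by (auto intro!: tendsto_eq_intros)
    qed
    then show ?thesis using 3 by (simp add: DERIV_def flat_exp_def)
  qed
qed

lemma C_k_flat_exp: "C_k k (\<lambda>x. flat_exp j (c * x $ i + d))"
proof (induction k arbitrary: j)
  case 0
  have "continuous_on UNIV (flat_exp j)"
    using flat_exp_has_derivative DERIV_isCont by (blast intro: continuous_at_imp_continuous_on)
  then show ?case by (auto intro!: continuous_intros continuous_on_compose2[of UNIV "flat_exp j"])
next
  case (Suc k)
  have D: "((\<lambda>x. flat_exp j (c * x $ i + d)) has_derivative
      (\<lambda>h. (c * h $ i) * (flat_exp (j + 2) (c * x $ i + d) + (- real j) * flat_exp (j + 1) (c * x $ i + d)))) (at x)" for x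
  proof -
    have "((\<lambda>x. c * x $ i + d) has_derivative (\<lambda>h. c * h $ i)) (at x)"
      by (auto intro!: derivative_eq_intros bounded_linear.has_derivative[OF bounded_linear_vec_nth])
    from DERIV_compose_FDERIV[OF flat_exp_has_derivative this] show ?thesis
      by (simp add: algebra_simps)
  qed
  have "partial_deriv \<alpha> (\<lambda>x. flat_exp j (c * x $ i + d)) = (\<lambda>x. (c * axis \<alpha> 1 $ i) *
      (flat_exp (j + 2) (c * x $ i + d) + (- real j) * flat_exp (j + 1) (c * x $ i + d)))" for \<alpha>
    by (intro ext partial_deriv_eq[OF D])
  moreover have "C_k k (\<lambda>x. (c * axis \<alpha> 1 $ i) *
      (flat_exp (j + 2) (c * x $ i + d) + (- real j) * flat_exp (j + 1) (c * x $ i + d)))" for \<alpha>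
    by (intro C_k_mult C_k_add C_k_const Suc)
  ultimately show ?case using D by (auto simp: differentiable_def)
qed

lemma smooth_flat_exp: "smooth (\<lambda>x. flat_exp j (c * x $ i + d))"
  by (simp add: smooth_def C_k_flat_exp)

text \<open>A product of factors exp(-1/(n (x_i - a_i))) and exp(-1/(n (b_i - x_i))), cut off to 0
  outside the open box; as n grows, each factor tends to 1 inside. The arguments are written in the
  affine form c * x $ i + d expected by \<open>smooth_flat_exp\<close>.\<close>

definition box_bump :: "real^2 \<Rightarrow> real^2 \<Rightarrow> nat \<Rightarrow> real^2 \<Rightarrow> real" where
  "box_bump a b n x = (\<Prod>i\<in>UNIV. flat_exp 0 (n * x $ i + - (n * a $ i)) * flat_exp 0 (- real n * x $ i + n * b $ i))"

lemma smooth_box_bump: "smooth (box_bump a b n)"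
  unfolding box_bump_def by (intro smooth_prod smooth_mult finite smooth_flat_exp)

lemma flat_exp_range: "0 \<le> flat_exp 0 t" "flat_exp 0 t \<le> 1"
  by (auto simp: flat_exp_def)

lemma box_bump_bounds: "0 \<le> box_bump a b n x" "box_bump a b n x \<le> 1"
  unfolding box_bump_def
  by (auto intro!: prod_nonneg prod_le_1 mult_nonneg_nonneg mult_le_one flat_exp_range)

lemma box_bump_eq_0: "x \<notin> box a b \<Longrightarrow> box_bump a b n x = 0"
proof -
  assume "x \<notin> box a b"
  then obtain i where i: "x $ i \<le> a $ i \<or> b $ i \<le> x $ i"
    unfolding mem_box_cart by (auto simp: not_less)
  have "flat_exp 0 (n * x $ i + - (n * a $ i)) * flat_exp 0 (- real n * x $ i + n * b $ i) = 0"
    using i mult_left_mono[of "x $ i" "a $ i" "real n"] mult_left_mono[of "b $ i" "x $ i" "real n"]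
    by (auto simp: flat_exp_def)
  then show ?thesis unfolding box_bump_def by (intro prod_zero) auto
qed

lemma box_bump_tendsto: "(\<lambda>n. box_bump a b n x) \<longlonglongrightarrow> indicator (box a b) x"
proof (cases "x \<in> box a b")
  case True
  have lim: "(\<lambda>n. flat_exp 0 (real n * t)) \<longlonglongrightarrow> 1" if "t > 0" for t
  proof (rule Lim_transform_eventually)
    have "(\<lambda>n. - (1 / t) * (1 / real n)) \<longlonglongrightarrow> - (1 / t) * 0"
      by (intro tendsto_intros lim_1_over_n)
    then show "(\<lambda>n. exp (- (1 / t) * (1 / real n))) \<longlonglongrightarrow> 1"
      by (metis exp_zero mult_zero_right tendsto_exp)
    show "\<forall>\<^sub>F n in sequentially. exp (- (1 / t) * (1 / real n)) = flat_exp 0 (real n * t)"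
      using eventually_gt_at_top[of "0::nat"] by eventually_elim (use that in \<open>simp add: flat_exp_def mult_ac\<close>)
  qed
  have "(\<lambda>n. \<Prod>i\<in>UNIV. flat_exp 0 (real n * (x $ i - a $ i)) * flat_exp 0 (real n * (b $ i - x $ i)))
      \<longlonglongrightarrow> (\<Prod>i\<in>(UNIV :: 2 set). 1 * 1)"
    using True by (intro tendsto_prod tendsto_mult lim) (auto simp: mem_box_cart)
  then show ?thesis using True by (simp add: box_bump_def algebra_simps)
qed (simp add: box_bump_eq_0)

lemma test_function_box_bump:
  assumes "cbox a b \<subseteq> \<omega>"
  shows "test_function \<omega> (box_bump a b n)"
proof -
  have "{x. box_bump a b n x \<noteq> 0} \<subseteq> cbox a b"
    using box_bump_eq_0 box_subset_cbox by blast
  then have "closure {x. box_bump a b n x \<noteq> 0} \<subseteq> cbox a b"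
    by (rule closure_minimal[OF _ closed_cbox])
  moreover have "bounded {x. box_bump a b n x \<noteq> 0}"
    using bounded_cbox bounded_subset calculation closure_subset by metis
  ultimately show ?thesis
    unfolding test_function_def using assms smooth_box_bump by auto
qed

section \<open>Uniqueness of weak derivatives\<close>

text \<open>On the compact support K the product has a bounded continuous factor and an integrable
  one, and off K it is zero. Local integrability thus yields integrability on the whole
  plane.\<close>

lemma test_function_scaleR_absolutely_integrable:
  fixes f :: "real^2 \<Rightarrow> 'b::euclidean_space"
  assumes \<theta>: "test_function \<omega> \<theta>"
    and f: "\<And>K. compact K \<Longrightarrow> K \<subseteq> \<omega> \<Longrightarrow> f absolutely_integrable_on K"
  shows "(\<lambda>x. \<theta> x *\<^sub>R f x) absolutely_integrable_on UNIV"
proof -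
  define K where "K = closure {x. \<theta> x \<noteq> 0}"
  have K: "compact K" "K \<subseteq> \<omega>" and cont: "continuous_on K \<theta>"
    using \<theta> smooth_continuous_on by (auto simp: test_function_def K_def)
  have "(\<lambda>x. \<theta> x *\<^sub>R f x) absolutely_integrable_on K"
  proof (rule absolutely_integrable_bounded_measurable_product[of "(*\<^sub>R)" \<theta> K f])
    show "bilinear ((*\<^sub>R) :: real \<Rightarrow> 'b \<Rightarrow> 'b)"
      by (simp add: bilinear_conv_bounded_bilinear bounded_bilinear_scaleR)
    show "\<theta> \<in> borel_measurable (lebesgue_on K)" "K \<in> sets lebesgue"
      using K(1) cont by (auto intro: continuous_imp_measurable_on_sets_lebesgue lmeasurable_compact fmeasurableD)
    show "bounded (\<theta> ` K)"
      using K(1) cont by (simp add: compact_imp_bounded compact_continuous_image)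
  qed (use f K in auto)
  then have "(\<lambda>x. if x \<in> K then \<theta> x *\<^sub>R f x else 0) absolutely_integrable_on UNIV"
    by (simp only: absolutely_integrable_restrict_UNIV)
  moreover have "(\<lambda>x. if x \<in> K then \<theta> x *\<^sub>R f x else 0) = (\<lambda>x. \<theta> x *\<^sub>R f x)"
    using closure_subset[of "{x. \<theta> x \<noteq> 0}"] by (auto simp: K_def fun_eq_iff)
  ultimately show ?thesis by simp
qed

lemma absolutely_integrable_UNIV_imp_integrable_on:
  fixes f :: "'a::euclidean_space \<Rightarrow> 'b::euclidean_space"
  assumes "f absolutely_integrable_on UNIV" "S \<in> sets lebesgue"
  shows "integrable (lebesgue_on S) f"
  using set_integrable_subset[OF assms] assms(2)
  by (simp add: integrable_restrict_space set_integrable_def)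

text \<open>The bumps are bounded by 1 and converge to the indicator of the open box, so |f|
  dominates the products and the limit is the integral of f over the box up to its negligible
  frontier.\<close>

lemma integral_cbox_eq_0_if_test_integrals_eq_0:
  fixes f :: "real^2 \<Rightarrow> real"
  assumes \<omega>: "open \<omega>"
    and f: "\<And>K. compact K \<Longrightarrow> K \<subseteq> \<omega> \<Longrightarrow> f absolutely_integrable_on K"
    and 0: "\<And>\<theta>. test_function \<omega> \<theta> \<Longrightarrow> (LINT x|lebesgue_on \<omega>. \<theta> x * f x) = 0"
    and sub: "cbox a b \<subseteq> \<omega>"
  shows "integral (cbox a b) f = 0"
proof -
  define h where "h n x = box_bump a b n x * f x" for n x
  have ai: "h n absolutely_integrable_on UNIV" for n
    using test_function_scaleR_absolutely_integrable[OF test_function_box_bump[OF sub] f]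
    by (simp add: h_def[abs_def])
  have 0: "integral (cbox a b) (h n) = 0" for n
  proof -
    have "integral \<omega> (h n) = (LINT x|lebesgue_on \<omega>. h n x)"
      using ai[of n] \<omega> by (intro lebesgue_integral_eq_integral[symmetric]
          absolutely_integrable_UNIV_imp_integrable_on) (auto simp: lmeasurable_open)
    also have "\<dots> = 0" using 0[OF test_function_box_bump[OF sub]] by (simp add: h_def)
    finally have "integral \<omega> (h n) = 0" .
    moreover have z: "h n x = 0" if "x \<notin> cbox a b" for x
      using that box_bump_eq_0[of x a b n] box_subset_cbox[of a b] by (auto simp: h_def)
    have "(\<lambda>x. if x \<in> \<omega> then h n x else 0) = h n" "(\<lambda>x. if x \<in> cbox a b then h n x else 0) = h n"
      using z sub by (fastforce simp: fun_eq_iff)+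
    then have "integral \<omega> (h n) = integral (cbox a b) (h n)"
      using integral_restrict_UNIV[of \<omega> "h n"] integral_restrict_UNIV[of "cbox a b" "h n"] by simp
    ultimately show ?thesis by simp
  qed
  have fi: "f absolutely_integrable_on cbox a b" using f sub by simp
  have "(\<lambda>n. integral (cbox a b) (h n)) \<longlonglongrightarrow> integral (cbox a b) (\<lambda>x. indicator (box a b) x * f x)"
  proof (rule dominated_convergence(2))
    show "h n integrable_on cbox a b" for n
      using set_integrable_subset[OF ai[of n], of "cbox a b"]
      by (simp add: set_lebesgue_integral_eq_integral)
    show "(\<lambda>x. \<bar>f x\<bar>) integrable_on cbox a b"
      using set_lebesgue_integral_eq_integral(1)[OF absolutely_integrable_norm[OF fi]]
      by (simp add: o_def)
    show "norm (h n x) \<le> \<bar>f x\<bar>" for n x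
      using box_bump_bounds[of a b n x] by (simp add: h_def abs_mult mult_left_le_one_le)
    show "(\<lambda>n. h n x) \<longlonglongrightarrow> indicator (box a b) x * f x" for x
      unfolding h_def by (intro tendsto_mult box_bump_tendsto tendsto_const)
  qed
  then have "integral (cbox a b) (\<lambda>x. indicator (box a b) x * f x) = 0"
    by (simp add: 0 LIMSEQ_const_iff)
  moreover have "integral (cbox a b) (\<lambda>x. indicator (box a b) x * f x) = integral (cbox a b) f"
    by (rule integral_spike[OF negligible_frontier_interval[of a b]]) auto
  ultimately show ?thesis by simp
qed

lemma AE_lebesgue_on_if_negligible:
  assumes "S \<in> sets lebesgue" "negligible {x \<in> S. \<not> P x}"
  shows "AE x in lebesgue_on S. P x"
proof -
  have "AE x in lebesgue. x \<notin> {x \<in> S. \<not> P x}"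
    using assms(2) by (intro AE_not_in) (simp add: negligible_iff_null_sets)
  then show ?thesis
    using assms(1) by (subst AE_restrict_space_iff) auto
qed

text \<open>The fundamental lemma of the calculus of variations. Integrals over all boxes inside
  \<omega> vanish, and by Lebesgue differentiation f is almost everywhere the limit of its means
  over shrinking cubes.\<close>

lemma AE_eq_0_if_test_integrals_eq_0:
  fixes f :: "real^2 \<Rightarrow> real"
  assumes \<omega>: "open \<omega>"
    and f: "\<And>K. compact K \<Longrightarrow> K \<subseteq> \<omega> \<Longrightarrow> f absolutely_integrable_on K"
    and 0: "\<And>\<theta>. test_function \<omega> \<theta> \<Longrightarrow> (LINT x|lebesgue_on \<omega>. \<theta> x * f x) = 0"
  shows "AE x in lebesgue_on \<omega>. f x = 0"
proof -
  note int0 = integral_cbox_eq_0_if_test_integrals_eq_0[OF \<omega> f 0]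
  have neg: "negligible {x \<in> cbox a b. f x \<noteq> 0}" if sub: "cbox a b \<subseteq> \<omega>" for a b
  proof -
    \<comment> \<open>Extension by zero makes the function integrable on every box, as the
      differentiation theorem demands; near interior points it agrees with f.\<close>
    define g where "g x = (if x \<in> cbox a b then f x else 0)" for x
    have "f integrable_on cbox a b"
      using f[OF compact_cbox sub] set_lebesgue_integral_eq_integral(1) by blast
    then have "g integrable_on UNIV"
      unfolding g_def by (simp only: integrable_restrict_UNIV)
    then have "g integrable_on cbox c d" for c d
      by (rule integrable_on_subcbox) simp
    then obtain N where N: "negligible N" "\<And>x e. \<lbrakk>x \<notin> N; 0 < e\<rbrakk> \<Longrightarrow>
        \<exists>d>0. \<forall>h. 0 < h \<and> h < d \<longrightarrow>
           norm (integral (cbox x (x + h *\<^sub>R One)) g /\<^sub>R h ^ DIM(real^2) - g x) < e"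
      using integrable_ccontinuous_explicit[of g] by blast
    have "f x = 0" if x: "x \<in> box a b" "x \<notin> N" for x
    proof -
      have "norm (g x) < e" if e: "e > 0" for e
      proof -
        obtain d where d: "d > 0" "\<And>h. 0 < h \<and> h < d \<Longrightarrow>
            norm (integral (cbox x (x + h *\<^sub>R One)) g /\<^sub>R h ^ DIM(real^2) - g x) < e"
          using N(2)[OF x(2) e] by blast
        obtain r where r: "r > 0" "cball x r \<subseteq> box a b"
          using x(1) open_box open_contains_cball by blast
        \<comment> \<open>Halving d makes h strictly smaller than d, and dividing r by the length of
          the diagonal keeps the far corner of the cube in the ball.\<close>
        define h where "h = min (d / 2) (r / norm (One :: real^2))"
        have One: "norm (One :: real^2) > 0" by simp
        have h: "0 < h" "h < d" "h * norm (One :: real^2) \<le> r"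
          using d(1) r(1) One by (auto simp: h_def min_def field_simps)
        have "x + h *\<^sub>R One \<in> cball x r" using h by (simp add: dist_norm)
        then have "x + h *\<^sub>R One \<in> box a b" using r(2) by blast
        then have "cbox x (x + h *\<^sub>R One) \<subseteq> cbox a b"
          using x(1) by (intro subset_box_imp(1)) (auto simp: mem_box less_imp_le)
        then have "integral (cbox x (x + h *\<^sub>R One)) g = integral (cbox x (x + h *\<^sub>R One)) f"
            and "cbox x (x + h *\<^sub>R One) \<subseteq> \<omega>"
          using sub by (auto intro!: Henstock_Kurzweil_Integration.integral_cong simp: g_def)
        then show ?thesis using d(2)[of h] h int0 by simp
      qed
      then have "g x = 0" by (metis less_irrefl zero_less_norm_iff)
      then show ?thesis using x(1) box_subset_cbox[of a b] by (auto simp: g_def)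
    qed
    then have "{x \<in> cbox a b. f x \<noteq> 0} \<subseteq> N \<union> (cbox a b - box a b)" by auto
    then show ?thesis
      by (rule negligible_subset[OF negligible_Un[OF N(1) negligible_frontier_interval]])
  qed
  obtain D where D: "countable D" "D \<subseteq> Pow \<omega>" "\<And>X. X \<in> D \<Longrightarrow> \<exists>a b. X = cbox a b" "\<Union>D = \<omega>"
    using open_countable_Union_open_cbox[OF \<omega>] by blast
  have "negligible (\<Union>((\<lambda>X. {x \<in> X. f x \<noteq> 0}) ` D))"
    using D neg by (intro negligible_countable_Union) (auto, blast)
  moreover have "{x \<in> \<omega>. f x \<noteq> 0} = \<Union>((\<lambda>X. {x \<in> X. f x \<noteq> 0}) ` D)" using D(4) by auto
  ultimately show ?thesis using \<omega> by (intro AE_lebesgue_on_if_negligible) auto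
qed

lemma has_weak_partial_unique:
  assumes \<omega>: "open \<omega>" and g: "has_weak_partial \<omega> \<alpha> f g" and h: "has_weak_partial \<omega> \<alpha> f h"
  shows "AE x in lebesgue_on \<omega>. g x = h x"
proof -
  have gi: "\<And>K. compact K \<Longrightarrow> K \<subseteq> \<omega> \<Longrightarrow> g absolutely_integrable_on K"
    and hi: "\<And>K. compact K \<Longrightarrow> K \<subseteq> \<omega> \<Longrightarrow> h absolutely_integrable_on K"
    using g h by (auto simp: has_weak_partial_def locally_integrable_def)
  have L: "\<omega> \<in> sets lebesgue" using \<omega> by auto
  have "AE x in lebesgue_on \<omega>. g x $ k - h x $ k = 0" for k
  proof (rule AE_eq_0_if_test_integrals_eq_0[OF \<omega>])
    fix K assume "compact K" "K \<subseteq> \<omega>"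
    then show "(\<lambda>x. g x $ k - h x $ k) absolutely_integrable_on K"
      using absolutely_integrable_component[OF set_integral_diff(1)[OF gi hi], where b = "axis k 1"]
      by (simp add: inner_axis)
  next
    fix \<theta> assume \<theta>: "test_function \<omega> \<theta>"
    note gt = absolutely_integrable_UNIV_imp_integrable_on[OF test_function_scaleR_absolutely_integrable[OF \<theta> gi] L]
    note ht = absolutely_integrable_UNIV_imp_integrable_on[OF test_function_scaleR_absolutely_integrable[OF \<theta> hi] L]
    have "(LINT x|lebesgue_on \<omega>. \<theta> x *\<^sub>R g x) = (LINT x|lebesgue_on \<omega>. \<theta> x *\<^sub>R h x)"
      using g h \<theta> unfolding has_weak_partial_def by (metis (no_types, lifting) neg_equal_iff_equal)
    then have "(LINT x|lebesgue_on \<omega>. \<theta> x *\<^sub>R g x - \<theta> x *\<^sub>R h x) = 0"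
      using gt ht by simp
    then have "(LINT x|lebesgue_on \<omega>. (\<theta> x *\<^sub>R g x - \<theta> x *\<^sub>R h x) \<bullet> axis k 1) = 0"
      using gt ht by (subst integral_inner_left) auto
    then show "(LINT x|lebesgue_on \<omega>. \<theta> x * (g x $ k - h x $ k)) = 0"
      by (simp add: inner_axis algebra_simps)
  qed
  then have "AE x in lebesgue_on \<omega>. \<forall>k. g x $ k - h x $ k = 0"
    by (simp add: AE_all_countable)
  then show ?thesis by eventually_elim (simp add: vec_eq_iff)
qed

lemma has_weak_partial_weak_partial:
  "has_weak_partial \<omega> \<alpha> f g \<Longrightarrow> has_weak_partial \<omega> \<alpha> f (weak_partial \<omega> \<alpha> f)"
  unfolding weak_partial_def by (rule someI[of "has_weak_partial \<omega> \<alpha> f"])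

text \<open>For a general class L the representative picked by \<open>weak_partial\<close> is only
  compared almost everywhere with a member of L.\<close>

lemma sobolev1_weak_partial:
  assumes "open \<omega>" "f \<in> sobolev1 \<omega> L"
  shows "\<exists>g\<in>L. AE x in lebesgue_on \<omega>. weak_partial \<omega> \<alpha> f x = g x"
proof -
  obtain g where g: "g \<in> L" "has_weak_partial \<omega> \<alpha> f g"
    using assms(2) unfolding sobolev1_def by blast
  then have "has_weak_partial \<omega> \<alpha> f (weak_partial \<omega> \<alpha> f)"
    using has_weak_partial_weak_partial by blast
  from has_weak_partial_unique[OF assms(1) this g(2)]
  show "\<exists>g\<in>L. AE x in lebesgue_on \<omega>. weak_partial \<omega> \<alpha> f x = g x"
    using g(1) by blast
qed

section \<open>Commuting partial derivatives\<close>

lemma partial_deriv_line: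
  fixes f :: "real^2 \<Rightarrow> real"
  assumes "\<And>x. f differentiable (at x)"
  shows "((\<lambda>s. f (y + s *\<^sub>R axis \<alpha> 1)) has_real_derivative partial_deriv \<alpha> f (y + s *\<^sub>R axis \<alpha> 1)) (at s)"
proof -
  define f' where "f' = frechet_derivative f (at (y + s *\<^sub>R axis \<alpha> 1))"
  have f': "(f has_derivative f') (at (y + s *\<^sub>R axis \<alpha> 1))"
    using assms unfolding f'_def frechet_derivative_works by blast
  have "((\<lambda>s. y + s *\<^sub>R axis \<alpha> 1) has_derivative (\<lambda>h. h *\<^sub>R axis \<alpha> 1)) (at s)"
    by (auto intro!: derivative_eq_intros)
  from has_derivative_compose[OF this f']
  have "((\<lambda>s. f (y + s *\<^sub>R axis \<alpha> 1)) has_derivative (\<lambda>h. h * f' (axis \<alpha> 1))) (at s)"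
    by (simp add: linear_simps(5)[OF has_derivative_bounded_linear[OF f']])
  moreover have "(\<lambda>h. h * f' (axis \<alpha> 1)) = (*) (f' (axis \<alpha> 1))"
    by (simp add: fun_eq_iff)
  ultimately show ?thesis
    by (simp add: has_field_derivative_def partial_deriv_def f'_def)
qed

text \<open>The mean value theorem applied twice: to the difference in direction \<beta> as a
  function of the shift s in direction \<alpha>, and to the derivative in direction \<alpha> along
  direction \<beta>.\<close>

lemma second_difference_mvt:
  fixes f :: "real^2 \<Rightarrow> real"
  assumes f: "C_k 2 f" and t: "t > 0"
  shows "\<exists>s r. 0 \<le> s \<and> s \<le> t \<and> 0 \<le> r \<and> r \<le> t \<and>
    f (x + t *\<^sub>R axis \<alpha> 1 + t *\<^sub>R axis \<beta> 1) - f (x + t *\<^sub>R axis \<alpha> 1) - f (x + t *\<^sub>R axis \<beta> 1) + f x =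
    t\<^sup>2 * partial_deriv \<beta> (partial_deriv \<alpha> f) (x + s *\<^sub>R axis \<alpha> 1 + r *\<^sub>R axis \<beta> 1)"
proof -
  have d: "\<And>x. f differentiable (at x)" "\<And>x. partial_deriv \<alpha> f differentiable (at x)"
    using f by (auto simp: numeral_2_eq_2)
  define g where "g s = f ((x + t *\<^sub>R axis \<beta> 1) + s *\<^sub>R axis \<alpha> 1) - f (x + s *\<^sub>R axis \<alpha> 1)" for s
  have "\<exists>s>0. s < t \<and> g t - g 0 = (t - 0) *
      (partial_deriv \<alpha> f ((x + t *\<^sub>R axis \<beta> 1) + s *\<^sub>R axis \<alpha> 1) - partial_deriv \<alpha> f (x + s *\<^sub>R axis \<alpha> 1))"
    unfolding g_def by (intro MVT2 t DERIV_diff partial_deriv_line d)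
  then obtain s where s: "0 < s" "s < t" "g t - g 0 = t *
      (partial_deriv \<alpha> f ((x + t *\<^sub>R axis \<beta> 1) + s *\<^sub>R axis \<alpha> 1) - partial_deriv \<alpha> f (x + s *\<^sub>R axis \<alpha> 1))"
    by auto
  define y where "y = x + s *\<^sub>R axis \<alpha> 1"
  have "\<exists>r>0. r < t \<and> partial_deriv \<alpha> f (y + t *\<^sub>R axis \<beta> 1) - partial_deriv \<alpha> f (y + 0 *\<^sub>R axis \<beta> 1) =
      (t - 0) * partial_deriv \<beta> (partial_deriv \<alpha> f) (y + r *\<^sub>R axis \<beta> 1)"
    by (intro MVT2 t partial_deriv_line d)
  then obtain r where r: "0 < r" "r < t" "partial_deriv \<alpha> f (y + t *\<^sub>R axis \<beta> 1) - partial_deriv \<alpha> f y =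
      t * partial_deriv \<beta> (partial_deriv \<alpha> f) (y + r *\<^sub>R axis \<beta> 1)"
    by auto
  have "g t - g 0 = t\<^sup>2 * partial_deriv \<beta> (partial_deriv \<alpha> f) (y + r *\<^sub>R axis \<beta> 1)"
    using s(3) r(3) by (simp add: y_def power2_eq_square add_ac)
  then show ?thesis using s r
    by (intro exI[of _ s] exI[of _ r]) (auto simp: g_def y_def add_ac)
qed

text \<open>Schwarz's theorem. The second difference is symmetric in \<alpha> and \<beta>, so the
  two mixed derivatives agree at two points within distance 2 t of x; continuity lets t tend to
  0.\<close>

lemma partial_deriv_commute:
  fixes f :: "real^2 \<Rightarrow> real"
  assumes f: "C_k 2 f"
  shows "partial_deriv \<beta> (partial_deriv \<alpha> f) x = partial_deriv \<alpha> (partial_deriv \<beta> f) x"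
proof -
  define P where "P = partial_deriv \<beta> (partial_deriv \<alpha> f)"
  define Q where "Q = partial_deriv \<alpha> (partial_deriv \<beta> f)"
  have "continuous_on UNIV P" "continuous_on UNIV Q"
    using f by (auto simp: P_def Q_def numeral_2_eq_2)
  then have c: "isCont P x" "isCont Q x" by (auto simp: continuous_on_eq_continuous_at)
  have "\<bar>P x - Q x\<bar> \<le> e" if "e > 0" for e
  proof -
    have e: "e / 2 > 0" using that by simp
    obtain d1 where d1: "d1 > 0" "\<And>y. dist y x < d1 \<Longrightarrow> dist (P y) (P x) < e / 2"
      using c(1) e unfolding continuous_at_eps_delta by blast
    obtain d2 where d2: "d2 > 0" "\<And>y. dist y x < d2 \<Longrightarrow> dist (Q y) (Q x) < e / 2"
      using c(2) e unfolding continuous_at_eps_delta by blast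
    define t where "t = min d1 d2 / 3"
    have t: "t > 0" "2 * t < d1" "2 * t < d2" using d1 d2 by (auto simp: t_def min_def)
    have near: "dist (x + s *\<^sub>R axis i 1 + r *\<^sub>R axis j 1) x \<le> 2 * t"
      if "0 \<le> s" "s \<le> t" "0 \<le> r" "r \<le> t" for s r and i j :: 2
      using that norm_triangle_ineq[of "s *\<^sub>R axis i (1::real)" "r *\<^sub>R axis j (1::real)"]
      by (simp add: dist_norm add.assoc)
    obtain s r where sr: "0 \<le> s" "s \<le> t" "0 \<le> r" "r \<le> t"
      "f (x + t *\<^sub>R axis \<alpha> 1 + t *\<^sub>R axis \<beta> 1) - f (x + t *\<^sub>R axis \<alpha> 1) - f (x + t *\<^sub>R axis \<beta> 1) + f x =
        t\<^sup>2 * P (x + s *\<^sub>R axis \<alpha> 1 + r *\<^sub>R axis \<beta> 1)"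
      using second_difference_mvt[OF f t(1)] unfolding P_def by blast
    obtain s' r' where sr': "0 \<le> s'" "s' \<le> t" "0 \<le> r'" "r' \<le> t"
      "f (x + t *\<^sub>R axis \<beta> 1 + t *\<^sub>R axis \<alpha> 1) - f (x + t *\<^sub>R axis \<beta> 1) - f (x + t *\<^sub>R axis \<alpha> 1) + f x =
        t\<^sup>2 * Q (x + s' *\<^sub>R axis \<beta> 1 + r' *\<^sub>R axis \<alpha> 1)"
      using second_difference_mvt[OF f t(1)] unfolding Q_def by blast
    have "t\<^sup>2 * P (x + s *\<^sub>R axis \<alpha> 1 + r *\<^sub>R axis \<beta> 1) = t\<^sup>2 * Q (x + s' *\<^sub>R axis \<beta> 1 + r' *\<^sub>R axis \<alpha> 1)"
      unfolding sr(5)[symmetric] sr'(5)[symmetric] by (simp add: add_ac)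
    then have "P (x + s *\<^sub>R axis \<alpha> 1 + r *\<^sub>R axis \<beta> 1) = Q (x + s' *\<^sub>R axis \<beta> 1 + r' *\<^sub>R axis \<alpha> 1)"
      using t(1) by simp
    moreover have "\<bar>P (x + s *\<^sub>R axis \<alpha> 1 + r *\<^sub>R axis \<beta> 1) - P x\<bar> < e / 2"
      using d1(2)[OF le_less_trans[OF near[OF sr(1-4)] t(2)]] unfolding dist_real_def .
    moreover have "\<bar>Q (x + s' *\<^sub>R axis \<beta> 1 + r' *\<^sub>R axis \<alpha> 1) - Q x\<bar> < e / 2"
      using d2(2)[OF le_less_trans[OF near[OF sr'(1-4)] t(3)]] unfolding dist_real_def .
    ultimately show ?thesis by linarith
  qed
  then have "\<bar>P x - Q x\<bar> \<le> 0 + e" if "e > 0" for e using that by simp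
  then have "\<bar>P x - Q x\<bar> \<le> 0" by (rule field_le_epsilon)
  then have "P x = Q x" by linarith
  then show ?thesis by (simp add: P_def Q_def)
qed

section \<open>Operations that preserve test functions\<close>

lemma compact_closure_subset: "closure S \<subseteq> K \<Longrightarrow> compact K \<Longrightarrow> compact (closure S)"
  using compact_Int_closed[of K "closure S"] by (simp add: inf.absorb2)

lemma test_function_partial_deriv:
  assumes "test_function \<omega> \<theta>"
  shows "test_function \<omega> (partial_deriv \<alpha> \<theta>)"
proof -
  define S where "S = {x. \<theta> x \<noteq> 0}"
  have "partial_deriv \<alpha> \<theta> x = 0" if "x \<in> - closure S" for x
  proof -
    have "((\<lambda>x. 0) has_derivative (\<lambda>h. 0)) (at x)" by simp
    then have "(\<theta> has_derivative (\<lambda>h. 0)) (at x)"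
      by (rule has_derivative_transform_within_open[OF _ _ that])
         (use closure_subset[of S] in \<open>auto simp: S_def\<close>)
    then show ?thesis using partial_deriv_eq by fastforce
  qed
  then have sub: "closure {x. partial_deriv \<alpha> \<theta> x \<noteq> 0} \<subseteq> closure S"
    by (intro closure_minimal) auto
  moreover have "compact (closure S)" using assms by (simp add: test_function_def S_def)
  ultimately have "compact (closure {x. partial_deriv \<alpha> \<theta> x \<noteq> 0})"
    using compact_closure_subset by blast
  then show ?thesis
    using assms sub smooth_partial_deriv unfolding test_function_def S_def by blast
qed

lemma test_function_mult_smooth:
  assumes "test_function \<omega> \<theta>" "smooth f"
  shows "test_function \<omega> (\<lambda>x. \<theta> x * f x)"
proof -
  have "closure {x. \<theta> x * f x \<noteq> 0} \<subseteq> closure {x. \<theta> x \<noteq> 0}" by (intro closure_mono) auto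
  moreover from this have "compact (closure {x. \<theta> x * f x \<noteq> 0})"
    using assms(1) compact_closure_subset unfolding test_function_def by blast
  ultimately show ?thesis using assms smooth_mult unfolding test_function_def by blast
qed

lemma test_function_bounded:
  assumes "test_function \<omega> \<theta>"
  obtains C where "\<And>x. \<bar>\<theta> x\<bar> \<le> C"
proof -
  define K where "K = closure {x. \<theta> x \<noteq> 0}"
  have "bounded (\<theta> ` K)"
    using assms smooth_continuous_on
    by (auto simp: test_function_def K_def intro!: compact_imp_bounded compact_continuous_image)
  then obtain C where C: "\<And>x. x \<in> K \<Longrightarrow> \<bar>\<theta> x\<bar> \<le> C" by (auto simp: bounded_iff)
  have "\<bar>\<theta> x\<bar> \<le> max C 0" for x
    using C[of x] closure_subset[of "{x. \<theta> x \<noteq> 0}"] by (cases "\<theta> x = 0") (auto simp: K_def)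
  then show ?thesis using that by blast
qed

text \<open>A weak gradient has zero curl in the sense of distributions: the derivatives of \<eta>
  are themselves test functions, so both sides are minus the integral of f against a mixed
  derivative of \<eta>.\<close>

lemma weak_partials_commute:
  assumes g: "has_weak_partial \<omega> \<alpha> f g" and h: "has_weak_partial \<omega> \<beta> f h" and \<eta>: "test_function \<omega> \<eta>"
  shows "(LINT x|lebesgue_on \<omega>. partial_deriv \<beta> \<eta> x *\<^sub>R g x) = (LINT x|lebesgue_on \<omega>. partial_deriv \<alpha> \<eta> x *\<^sub>R h x)"
proof -
  have "C_k 2 \<eta>" using \<eta> by (simp add: test_function_def smooth_def)
  then have "(LINT x|lebesgue_on \<omega>. partial_deriv \<alpha> (partial_deriv \<beta> \<eta>) x *\<^sub>R f x) =
      (LINT x|lebesgue_on \<omega>. partial_deriv \<beta> (partial_deriv \<alpha> \<eta>) x *\<^sub>R f x)"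
    by (simp add: partial_deriv_commute[of \<eta> \<alpha> \<beta>])
  moreover have "(LINT x|lebesgue_on \<omega>. partial_deriv \<alpha> (partial_deriv \<beta> \<eta>) x *\<^sub>R f x) =
      - (LINT x|lebesgue_on \<omega>. partial_deriv \<beta> \<eta> x *\<^sub>R g x)"
    using g test_function_partial_deriv[OF \<eta>] unfolding has_weak_partial_def by blast
  moreover have "(LINT x|lebesgue_on \<omega>. partial_deriv \<beta> (partial_deriv \<alpha> \<eta>) x *\<^sub>R f x) =
      - (LINT x|lebesgue_on \<omega>. partial_deriv \<alpha> \<eta> x *\<^sub>R h x)"
    using h test_function_partial_deriv[OF \<eta>] unfolding has_weak_partial_def by blast
  ultimately show ?thesis by simp
qed

section \<open>Symmetry of the second fundamental form\<close>

text \<open>A Young inequality with its scaling fixed in advance: when e^p has integral at most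
  \<delta>^p, the last term integrates to at most \<delta>, so every term on the right contributes a
  multiple of \<delta>. For e > \<delta> the quotient e / \<delta> exceeds 1 and its square is below
  its p-th power.\<close>

lemma mult_le_scaled_powr:
  fixes e b \<delta> p :: real
  assumes "p \<ge> 2" "\<delta> > 0" "e \<ge> 0" "b \<ge> 0"
  shows "e * b \<le> \<delta> * b\<^sup>2 + \<delta> + \<delta> powr (1 - p) * e powr p"
proof (cases "e \<le> \<delta>")
  case True
  have "b \<le> b\<^sup>2 + 1" using zero_le_power2[of "b - 1/2"] by (simp add: power2_eq_square algebra_simps)
  then have "\<delta> * b \<le> \<delta> * (b\<^sup>2 + 1)" using assms by (intro mult_left_mono) auto
  then have "\<delta> * b \<le> \<delta> * b\<^sup>2 + \<delta>" by (simp only: distrib_left mult_1_right)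
  moreover have "e * b \<le> \<delta> * b" using True assms by (simp add: mult_right_mono)
  moreover have "0 \<le> \<delta> powr (1 - p) * e powr p" by simp
  ultimately show ?thesis by linarith
next
  case False
  have "(e / \<delta>)\<^sup>2 \<le> (e / \<delta>) powr p"
    using False assms powr_mono[of 2 p "e / \<delta>"] by simp
  then have "\<delta> * (e / \<delta>)\<^sup>2 \<le> \<delta> * (e / \<delta>) powr p" using assms by simp
  also have "\<dots> = \<delta> powr (1 - p) * e powr p"
    using assms by (simp add: powr_divide powr_diff)
  finally have 1: "\<delta> * (e / \<delta>)\<^sup>2 \<le> \<delta> powr (1 - p) * e powr p" .
  have "2 * (b * (e / \<delta>)) \<le> b\<^sup>2 + (e / \<delta>)\<^sup>2"
    using zero_le_power2[of "b - e / \<delta>"] by (simp add: power2_diff)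
  moreover have "b\<^sup>2 \<ge> 0" "(e / \<delta>)\<^sup>2 \<ge> 0" "b * (e / \<delta>) \<ge> 0" using assms by auto
  ultimately have "b * (e / \<delta>) \<le> b\<^sup>2 + (e / \<delta>)\<^sup>2" by linarith
  then have "\<delta> * (b * (e / \<delta>)) \<le> \<delta> * (b\<^sup>2 + (e / \<delta>)\<^sup>2)"
    using assms by (intro mult_left_mono) auto
  then have "e * b \<le> \<delta> * b\<^sup>2 + \<delta> * (e / \<delta>)\<^sup>2"
    using assms by (simp add: distrib_left mult.commute del: power_divide)
  then show ?thesis using 1 assms by linarith
qed

lemma (in finite_measure) tendsto_integral_inner_0:
  fixes u :: "nat \<Rightarrow> 'a \<Rightarrow> 'b::euclidean_space"
  assumes p: "p \<ge> 2"
    and u [measurable]: "\<And>n. u n \<in> borel_measurable M"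
    and g [measurable]: "g \<in> borel_measurable M" and g2: "integrable M (\<lambda>x. (norm (g x))\<^sup>2)"
    and lim: "(\<lambda>n. \<integral>\<^sup>+x. ennreal (norm (u n x) powr p) \<partial>M) \<longlonglongrightarrow> 0"
    and \<theta> [measurable]: "\<theta> \<in> borel_measurable M" and C: "\<And>x. \<bar>\<theta> x\<bar> \<le> C"
  shows "(\<lambda>n. LINT x|M. \<theta> x * (u n x \<bullet> g x)) \<longlonglongrightarrow> 0"
proof (rule tendstoI)
  fix e :: real assume e: "e > 0"
  define B where "B = (LINT x|M. (norm (g x))\<^sup>2)"
  define \<mu> where "\<mu> = measure M (space M)"
  \<comment> \<open>Integrating the pointwise bound gives at most \<delta> K, with B from the square
    of g, \<mu> from the constant term and 1 from the p-th power; dividing e by K + 1 makes this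
    smaller than e even when K = 0.\<close>
  define K where "K = C * (B + \<mu> + 1)"
  define \<delta> where "\<delta> = e / (K + 1)"
  have C0: "C \<ge> 0" using C[of undefined] by linarith
  have K: "K \<ge> 0" using C0 by (simp add: K_def B_def \<mu>_def)
  then have \<delta>: "\<delta> > 0" using e by (simp add: \<delta>_def)
  then have "eventually (\<lambda>n. (\<integral>\<^sup>+x. ennreal (norm (u n x) powr p) \<partial>M) < ennreal (\<delta> powr p)) sequentially"
    using order_tendstoD(2)[OF lim, of "ennreal (\<delta> powr p)"] by simp
  then show "eventually (\<lambda>n. dist (LINT x|M. \<theta> x * (u n x \<bullet> g x)) 0 < e) sequentially"
  proof eventually_elim
    case (elim n)
    have int: "integrable M (\<lambda>x. norm (u n x) powr p)"
      using less_trans[OF elim ennreal_less_top] by (intro integrableI_bounded) simp_all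
    have le: "(LINT x|M. norm (u n x) powr p) \<le> \<delta> powr p"
    proof -
      have "ennreal (LINT x|M. norm (u n x) powr p) < ennreal (\<delta> powr p)"
        using elim nn_integral_eq_integral[OF int] by simp
      then show ?thesis by (subst (asm) ennreal_less_iff) auto
    qed
    define h where "h x = C * (\<delta> * (norm (g x))\<^sup>2 + \<delta> + \<delta> powr (1 - p) * norm (u n x) powr p)" for x
    have hint: "integrable M h" unfolding h_def using int g2 by simp
    have hle: "norm (\<theta> x * (u n x \<bullet> g x)) \<le> h x" for x
    proof -
      have "\<bar>\<theta> x * (u n x \<bullet> g x)\<bar> \<le> C * (norm (u n x) * norm (g x))"
        unfolding abs_mult using C C0 Cauchy_Schwarz_ineq2 by (intro mult_mono) auto
      also have "\<dots> \<le> h x"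
        unfolding h_def using C0 p \<delta> by (intro mult_left_mono mult_le_scaled_powr) auto
      finally show ?thesis by simp
    qed
    have "norm (LINT x|M. \<theta> x * (u n x \<bullet> g x)) \<le> (LINT x|M. h x)"
    proof (rule order_trans[OF integral_norm_bound integral_mono])
      have "integrable M (\<lambda>x. \<theta> x * (u n x \<bullet> g x))"
        by (rule Bochner_Integration.integrable_bound[OF hint]) (use hle in \<open>auto intro!: AE_I2 order_trans[OF _ abs_ge_self]\<close>)
      then show "integrable M (\<lambda>x. norm (\<theta> x * (u n x \<bullet> g x)))" by (rule integrable_norm)
    qed (use hint hle in auto)
    also have "\<dots> = C * (\<delta> * B + \<delta> * \<mu> + \<delta> powr (1 - p) * (LINT x|M. norm (u n x) powr p))"
      unfolding h_def using int g2 by (simp add: B_def \<mu>_def mult.commute)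
    also have "\<dots> \<le> C * (\<delta> * B + \<delta> * \<mu> + \<delta> powr (1 - p) * \<delta> powr p)"
      using le C0 by (intro mult_left_mono add_left_mono) auto
    also have "\<dots> = \<delta> * K"
      using \<delta> by (simp add: K_def powr_add[symmetric] algebra_simps)
    also have "\<dots> < e"
      using e K by (simp add: \<delta>_def field_simps)
    finally show ?case by (simp add: dist_real_def)
  qed
qed

lemma integrable_inner_if_square_integrable:
  fixes u g :: "'a \<Rightarrow> 'b::euclidean_space"
  assumes [measurable]: "u \<in> borel_measurable M" "g \<in> borel_measurable M" "\<theta> \<in> borel_measurable M"
    and sq: "integrable M (\<lambda>x. (norm (u x))\<^sup>2)" "integrable M (\<lambda>x. (norm (g x))\<^sup>2)"
    and C: "\<And>x. \<bar>\<theta> x\<bar> \<le> C"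
  shows "integrable M (\<lambda>x. \<theta> x * (u x \<bullet> g x))"
proof (rule Bochner_Integration.integrable_bound)
  show "integrable M (\<lambda>x. C * ((norm (u x))\<^sup>2 + (norm (g x))\<^sup>2))" using sq by simp
  have C0: "C \<ge> 0" using C[of undefined] by linarith
  have "norm (\<theta> x * (u x \<bullet> g x)) \<le> norm (C * ((norm (u x))\<^sup>2 + (norm (g x))\<^sup>2))" for x
  proof -
    have "norm (u x) * norm (g x) \<le> (norm (u x))\<^sup>2 + (norm (g x))\<^sup>2"
      using sum_squares_bound[of "norm (u x)" "norm (g x)"] mult_nonneg_nonneg[OF norm_ge_zero[of "u x"] norm_ge_zero[of "g x"]]
      by linarith
    then have "\<bar>\<theta> x\<bar> * \<bar>u x \<bullet> g x\<bar> \<le> C * ((norm (u x))\<^sup>2 + (norm (g x))\<^sup>2)"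
      using C C0 order_trans[OF Cauchy_Schwarz_ineq2] by (intro mult_mono) auto
    then show ?thesis using C0 by (simp add: abs_mult)
  qed
  then show "AE x in M. norm (\<theta> x * (u x \<bullet> g x)) \<le> norm (C * ((norm (u x))\<^sup>2 + (norm (g x))\<^sup>2))" by simp
qed simp

lemma Lp_square_integrable:
  assumes fin: "finite_measure (lebesgue_on \<omega>)" and p: "p \<ge> 2" and f: "f \<in> Lp p \<omega>"
  shows "integrable (lebesgue_on \<omega>) (\<lambda>x. (norm (f x))\<^sup>2)"
proof (rule Bochner_Integration.integrable_bound)
  interpret finite_measure "lebesgue_on \<omega>" by (rule fin)
  show "integrable (lebesgue_on \<omega>) (\<lambda>x. 1 + norm (f x) powr p)" using f by (simp add: Lp_def)
  have [measurable]: "f \<in> borel_measurable (lebesgue_on \<omega>)" using f by (simp add: Lp_def)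
  show "(\<lambda>x. (norm (f x))\<^sup>2) \<in> borel_measurable (lebesgue_on \<omega>)" by measurable
  have "t\<^sup>2 \<le> 1 + t powr p" if "t \<ge> 0" for t :: real
  proof (cases "t \<le> 1")
    case True
    then have "t\<^sup>2 \<le> 1" using that by (simp add: power_le_one)
    then show ?thesis by (simp add: add_increasing2)
  next
    case False
    then have "t\<^sup>2 \<le> t powr p" using p powr_mono[of 2 p t] by simp
    then show ?thesis by simp
  qed
  then show "AE x in lebesgue_on \<omega>. norm ((norm (f x))\<^sup>2) \<le> norm (1 + norm (f x) powr p)" by simp
qed

lemma smooth_borel_measurable:
  fixes h :: "real^2 \<Rightarrow> 'b::euclidean_space"
  assumes "smooth h" "S \<in> sets lebesgue"
  shows "h \<in> borel_measurable (lebesgue_on S)"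
  using smooth_continuous_on[OF assms(1)] assms(2) by (rule continuous_imp_measurable_on_sets_lebesgue)

text \<open>
  The second minors are null Lagrangians: for smooth \<open>F\<close> the field \<open>\<partial>\<^sub>\<alpha>F \<sqdot> \<partial>\<^sub>\<beta>\<psi> - \<partial>\<^sub>\<beta>F \<sqdot> \<partial>\<^sub>\<alpha>\<psi>\<close> is the
  divergence of \<open>F \<sqdot> \<nabla>\<psi>\<close> rotated by a right angle, and this survives the passage to the limit
  \<open>F \<rightarrow> f\<close>.
\<close>
lemma null_lagrangian_symmetric:
  fixes f \<psi> :: "real^2 \<Rightarrow> real^3" and f' g' :: "2 \<Rightarrow> real^2 \<Rightarrow> real^3"
  assumes \<omega>: "open \<omega>" "bounded \<omega>" and p: "p \<ge> 2"
    and f: "f \<in> Lp p \<omega>" "\<And>\<alpha>. f' \<alpha> \<in> Lp p \<omega>" and g: "\<And>\<alpha>. g' \<alpha> \<in> Lp p \<omega>"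
    and \<psi>: "\<And>\<alpha>. has_weak_partial \<omega> \<alpha> \<psi> (g' \<alpha>)"
    and F: "\<And>n. smooth (F n)"
    and lim: "(\<lambda>n. \<integral>\<^sup>+x. ennreal (norm (F n x - f x) powr p) \<partial>lebesgue_on \<omega>) \<longlonglongrightarrow> 0"
      "\<And>\<alpha>. (\<lambda>n. \<integral>\<^sup>+x. ennreal (norm (partial_deriv \<alpha> (F n) x - f' \<alpha> x) powr p) \<partial>lebesgue_on \<omega>) \<longlonglongrightarrow> 0"
    and orth: "\<And>\<alpha>. AE x in lebesgue_on \<omega>. f x \<bullet> g' \<alpha> x = 0"
  shows "AE x in lebesgue_on \<omega>. f' \<alpha> x \<bullet> g' \<beta> x = f' \<beta> x \<bullet> g' \<alpha> x"
proof -
  let ?M = "lebesgue_on \<omega>"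
  have L: "\<omega> \<in> sets lebesgue" using \<omega>(1) by auto
  have fin: "finite_measure ?M"
    using \<omega> by (intro finite_measure_lebesgue_on) (simp add: lmeasurable_open)
  interpret finite_measure ?M by (rule fin)
  have meas [measurable]: "f \<in> borel_measurable ?M" "\<And>\<alpha>. f' \<alpha> \<in> borel_measurable ?M"
      "\<And>\<alpha>. g' \<alpha> \<in> borel_measurable ?M"
    using f g by (auto simp: Lp_def)
  have sq: "integrable ?M (\<lambda>x. (norm (f x))\<^sup>2)" "\<And>\<alpha>. integrable ?M (\<lambda>x. (norm (f' \<alpha> x))\<^sup>2)"
      "\<And>\<alpha>. integrable ?M (\<lambda>x. (norm (g' \<alpha> x))\<^sup>2)"
    using Lp_square_integrable[OF fin p] f g by auto
  note smeas = smooth_borel_measurable[OF _ L]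
  \<comment> \<open>The approximations have no compact support; square integrability comes from
    their boundedness on the compact closure of \<omega>.\<close>
  have ssq: "integrable ?M (\<lambda>x. (norm (h x))\<^sup>2)" if h: "smooth h" for h :: "real^2 \<Rightarrow> real^3"
  proof -
    have "compact (h ` closure \<omega>)"
      using smooth_continuous_on[OF h] \<omega>(2) by (intro compact_continuous_image) auto
    then have "bounded (h ` closure \<omega>)" by (rule compact_imp_bounded)
    then obtain B where "\<forall>y\<in>h ` closure \<omega>. norm y \<le> B" unfolding bounded_iff by blast
    then have B: "\<And>x. x \<in> closure \<omega> \<Longrightarrow> norm (h x) \<le> B" by blast
    have "AE x in ?M. norm ((norm (h x))\<^sup>2) \<le> B\<^sup>2"
      using B closure_subset by (intro AE_I2) (auto intro!: power_mono)
    then show ?thesis using smeas[OF h] by (intro integrable_const_bound) auto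
  qed
  have conv: "(\<lambda>n. LINT x|?M. \<theta> x * (H n x \<bullet> g' \<beta> x)) \<longlonglongrightarrow> (LINT x|?M. \<theta> x * (h x \<bullet> g' \<beta> x))"
    if \<theta>: "test_function \<omega> \<theta>" and H: "\<And>n. smooth (H n)" and h: "h \<in> borel_measurable ?M"
      "integrable ?M (\<lambda>x. (norm (h x))\<^sup>2)"
      "(\<lambda>n. \<integral>\<^sup>+x. ennreal (norm (H n x - h x) powr p) \<partial>?M) \<longlonglongrightarrow> 0"
    for \<theta> \<beta> H h
  proof -
    obtain C where C: "\<And>x. \<bar>\<theta> x\<bar> \<le> C" using test_function_bounded[OF \<theta>] by blast
    have \<theta>m: "\<theta> \<in> borel_measurable ?M" using \<theta> by (intro smeas) (simp add: test_function_def)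
    note Hm = smeas[OF H]
    have "(\<lambda>n. LINT x|?M. \<theta> x * ((H n x - h x) \<bullet> g' \<beta> x)) \<longlonglongrightarrow> 0"
      using h(1,3) Hm sq(3) \<theta>m C by (intro tendsto_integral_inner_0[OF p]) auto
    moreover have "(LINT x|?M. \<theta> x * ((H n x - h x) \<bullet> g' \<beta> x)) =
        (LINT x|?M. \<theta> x * (H n x \<bullet> g' \<beta> x)) - (LINT x|?M. \<theta> x * (h x \<bullet> g' \<beta> x))" for n
    proof -
      have "integrable ?M (\<lambda>x. \<theta> x * (H n x \<bullet> g' \<beta> x))" "integrable ?M (\<lambda>x. \<theta> x * (h x \<bullet> g' \<beta> x))"
        using h(1,2) Hm sq(3) ssq[OF H] \<theta>m C meas(3) by (auto intro!: integrable_inner_if_square_integrable)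
      then show ?thesis by (simp add: inner_diff_left right_diff_distrib)
    qed
    ultimately show ?thesis by (simp add: LIM_zero_iff)
  qed
  have pint: "integrable ?M (\<lambda>x. \<theta> x * (h x \<bullet> g' \<beta> x))"
    if \<theta>: "test_function \<omega> \<theta>" and "h \<in> borel_measurable ?M" "integrable ?M (\<lambda>x. (norm (h x))\<^sup>2)" for \<theta> h \<beta>
  proof -
    obtain C where C: "\<And>x. \<bar>\<theta> x\<bar> \<le> C" using test_function_bounded[OF \<theta>] by blast
    have "\<theta> \<in> borel_measurable ?M" using \<theta> by (intro smeas) (simp add: test_function_def)
    then show ?thesis using that(2,3) sq(3) C meas(3) by (intro integrable_inner_if_square_integrable) auto
  qed
  have main: "(LINT x|?M. \<theta> x * (f' \<alpha> x \<bullet> g' \<beta> x)) = (LINT x|?M. \<theta> x * (f' \<beta> x \<bullet> g' \<alpha> x))"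
    if \<theta>: "test_function \<omega> \<theta>" for \<theta>
  proof -
    note \<theta>' = test_function_partial_deriv[OF \<theta>]
    \<comment> \<open>By the product rule this is the integral of the \<alpha>-derivative of
      \<theta> F_n against \<open>g' \<beta>\<close>. Componentwise \<theta> F_n is a test function,
      so the vanishing curl of the weak gradient makes \<open>I n\<close> symmetric in \<alpha> and
      \<beta>.\<close>
    define I where "I n \<alpha> \<beta> = (LINT x|?M. partial_deriv \<alpha> \<theta> x * (F n x \<bullet> g' \<beta> x)) +
        (LINT x|?M. \<theta> x * (partial_deriv \<alpha> (F n) x \<bullet> g' \<beta> x))" for n \<alpha> \<beta>
    define \<eta> where "\<eta> n k x = \<theta> x * F n x $ k" for n k x
    have \<eta>: "test_function \<omega> (\<eta> n k)" for n k
      unfolding \<eta>_def using \<theta> smooth_component[OF F] by (rule test_function_mult_smooth)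
    have d\<eta>: "partial_deriv \<alpha> (\<eta> n k) x = \<theta> x * partial_deriv \<alpha> (F n) x $ k + partial_deriv \<alpha> \<theta> x * F n x $ k"
      for \<alpha> n k x
      unfolding \<eta>_def
      using \<theta> F smooth_differentiable[OF smooth_component[OF F]]
      by (subst partial_deriv_mult) (auto simp: partial_deriv_component smooth_differentiable test_function_def)
    have \<eta>int: "integrable ?M (\<lambda>x. partial_deriv \<alpha> (\<eta> n k) x *\<^sub>R g' \<beta> x)" for \<alpha> \<beta> n k
      using \<psi>[of \<beta>] unfolding has_weak_partial_def locally_integrable_def
      by (intro absolutely_integrable_UNIV_imp_integrable_on[OF _ L]
          test_function_scaleR_absolutely_integrable[OF test_function_partial_deriv[OF \<eta>]]) auto
    have \<eta>int': "integrable ?M (\<lambda>x. partial_deriv \<alpha> (\<eta> n k) x * g' \<beta> x $ k)" for \<alpha> \<beta> n k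
    proof -
      have "integrable ?M (\<lambda>x. (partial_deriv \<alpha> (\<eta> n k) x *\<^sub>R g' \<beta> x) \<bullet> axis k 1)"
        by (intro integrable_inner_left \<eta>int)
      then show ?thesis by (simp add: inner_axis)
    qed
    have I: "I n \<alpha> \<beta> = (\<Sum>k\<in>UNIV. LINT x|?M. partial_deriv \<alpha> (\<eta> n k) x * g' \<beta> x $ k)" for n \<alpha> \<beta>
    proof -
      have "I n \<alpha> \<beta> = (LINT x|?M. partial_deriv \<alpha> \<theta> x * (F n x \<bullet> g' \<beta> x) +
          \<theta> x * (partial_deriv \<alpha> (F n) x \<bullet> g' \<beta> x))"
        unfolding I_def
        by (intro Bochner_Integration.integral_add[symmetric] pint \<theta> \<theta>' smeas ssq F smooth_partial_deriv)
      also have "\<dots> = (LINT x|?M. (\<Sum>k\<in>UNIV. partial_deriv \<alpha> (\<eta> n k) x * g' \<beta> x $ k))"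
        by (simp add: d\<eta> inner_vec_def sum_distrib_left algebra_simps sum.distrib)
      finally show ?thesis using \<eta>int' by simp
    qed
    have "(LINT x|?M. partial_deriv \<alpha> (\<eta> n k) x * g' \<beta> x $ k) =
        (LINT x|?M. partial_deriv \<beta> (\<eta> n k) x * g' \<alpha> x $ k)" for n k
    proof -
      have comp: "(LINT x|?M. partial_deriv \<alpha> (\<eta> n k) x * g' \<beta> x $ k) =
          (LINT x|?M. partial_deriv \<alpha> (\<eta> n k) x *\<^sub>R g' \<beta> x) \<bullet> axis k 1" for \<alpha> \<beta>
      proof -
        have "(LINT x|?M. (partial_deriv \<alpha> (\<eta> n k) x *\<^sub>R g' \<beta> x) \<bullet> axis k 1) =
            (LINT x|?M. partial_deriv \<alpha> (\<eta> n k) x *\<^sub>R g' \<beta> x) \<bullet> axis k 1"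
          by (intro integral_inner_left \<eta>int)
        then show ?thesis by (simp add: inner_axis)
      qed
      show ?thesis unfolding comp by (intro arg_cong2[where f = inner] refl weak_partials_commute[OF \<psi> \<psi> \<eta>])
    qed
    then have sym: "I n \<alpha> \<beta> = I n \<beta> \<alpha>" for n unfolding I by simp
    have "(\<lambda>n. I n \<alpha> \<beta>) \<longlonglongrightarrow> (LINT x|?M. partial_deriv \<alpha> \<theta> x * (f x \<bullet> g' \<beta> x)) +
        (LINT x|?M. \<theta> x * (f' \<alpha> x \<bullet> g' \<beta> x))" for \<alpha> \<beta>
      unfolding I_def
      by (intro tendsto_add conv \<theta> \<theta>' F smooth_partial_deriv meas sq lim)
    \<comment> \<open>The orthogonality is a property of the limit f and is not assumed for F_n;
      hence the term carrying the derivative of \<theta> is dropped only after the passage to the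
      limit.\<close>
    moreover have "(LINT x|?M. partial_deriv \<alpha> \<theta> x * (f x \<bullet> g' \<beta> x)) = 0" for \<alpha> \<beta>
      using orth[of \<beta>] by (intro integral_eq_zero_AE) auto
    ultimately have lims: "(\<lambda>n. I n \<alpha> \<beta>) \<longlonglongrightarrow> (LINT x|?M. \<theta> x * (f' \<alpha> x \<bullet> g' \<beta> x))" for \<alpha> \<beta>
      by simp
    show ?thesis using lims[of \<alpha> \<beta>] lims[of \<beta> \<alpha>] unfolding sym by (rule LIMSEQ_unique)
  qed
  have one: "integrable ?M (\<lambda>x. f' \<alpha> x \<bullet> g' \<beta> x)" for \<alpha> \<beta>
    using integrable_inner_if_square_integrable[of "f' \<alpha>" ?M "g' \<beta>" "\<lambda>x. 1" 1] sq meas by simp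
  have "AE x in ?M. f' \<alpha> x \<bullet> g' \<beta> x - f' \<beta> x \<bullet> g' \<alpha> x = 0"
  proof (rule AE_eq_0_if_test_integrals_eq_0[OF \<omega>(1)])
    fix K assume K: "compact K" "K \<subseteq> \<omega>"
    have "integrable ?M (\<lambda>x. f' \<alpha> x \<bullet> g' \<beta> x - f' \<beta> x \<bullet> g' \<alpha> x)" using one by simp
    then have "(\<lambda>x. f' \<alpha> x \<bullet> g' \<beta> x - f' \<beta> x \<bullet> g' \<alpha> x) absolutely_integrable_on \<omega>"
      using L by (simp add: integrable_restrict_space set_integrable_def)
    then show "(\<lambda>x. f' \<alpha> x \<bullet> g' \<beta> x - f' \<beta> x \<bullet> g' \<alpha> x) absolutely_integrable_on K"
      using K by (auto intro: set_integrable_subset lmeasurable_compact fmeasurableD)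
  next
    fix \<theta> assume \<theta>: "test_function \<omega> \<theta>"
    have "integrable ?M (\<lambda>x. \<theta> x * (f' \<alpha> x \<bullet> g' \<beta> x))" for \<alpha> \<beta>
      using \<theta> meas sq by (intro pint)
    then show "(LINT x|?M. \<theta> x * (f' \<alpha> x \<bullet> g' \<beta> x - f' \<beta> x \<bullet> g' \<alpha> x)) = 0"
      using main[OF \<theta>] by (simp add: right_diff_distrib)
  qed
  then show ?thesis by eventually_elim simp
qed

text \<open>\<open>a3\<close> is a multiple of the cross product of these very representatives, so
  orthogonality holds at every point, including those where the normal field vanishes and
  \<open>a3\<close> is 0 because 1 / 0 = 0.\<close>

lemma a3_inner_weak_partial: "a3 \<omega> \<psi> x \<bullet> weak_partial \<omega> \<alpha> \<psi> x = 0"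
proof -
  have "cross3 u v \<bullet> u = 0" "cross3 u v \<bullet> v = 0" for u v
    by (metis dot_cross_self inner_commute)+
  then show ?thesis using exhaust_2[of \<alpha>] by (auto simp: a3_def normal_field_def)
qed

lemma form_b_symmetric:
  assumes \<omega>: "open \<omega>" "bounded \<omega>" and p: "p \<ge> 2"
    and \<psi>: "\<psi> \<in> W1p p \<omega>" and a: "a3 \<omega> \<psi> \<in> W1p p \<omega>" and tr: "has_trace p \<omega> (a3 \<omega> \<psi>) t"
  shows "AE x in lebesgue_on \<omega>. form_b \<omega> \<psi> x $ \<alpha> $ \<beta> = form_b \<omega> \<psi> x $ \<beta> $ \<alpha>"
proof -
  let ?M = "lebesgue_on \<omega>"
  obtain g' where g': "\<And>\<alpha>. g' \<alpha> \<in> Lp p \<omega>" "\<And>\<alpha>. has_weak_partial \<omega> \<alpha> \<psi> (g' \<alpha>)"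
    using \<psi> unfolding sobolev1_def mem_Collect_eq by metis
  obtain f' where f': "\<And>\<alpha>. f' \<alpha> \<in> Lp p \<omega>" "\<And>\<alpha>. has_weak_partial \<omega> \<alpha> (a3 \<omega> \<psi>) (f' \<alpha>)"
    using a unfolding sobolev1_def mem_Collect_eq by metis
  have g'': "AE x in ?M. weak_partial \<omega> \<alpha> \<psi> x = g' \<alpha> x" for \<alpha>
    by (rule has_weak_partial_unique[OF \<omega>(1) has_weak_partial_weak_partial[OF g'(2)] g'(2)])
  have f'': "AE x in ?M. weak_partial \<omega> \<alpha> (a3 \<omega> \<psi>) x = f' \<alpha> x" for \<alpha>
    by (rule has_weak_partial_unique[OF \<omega>(1) has_weak_partial_weak_partial[OF f'(2)] f'(2)])
  obtain F :: "nat \<Rightarrow> real^2 \<Rightarrow> real^3" where F: "\<And>n. smooth (F n)"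
      "(\<lambda>n. \<integral>\<^sup>+x. ennreal (norm (F n x - a3 \<omega> \<psi> x) powr p) \<partial>?M) \<longlonglongrightarrow> 0"
      "\<And>\<alpha>. (\<lambda>n. \<integral>\<^sup>+x. ennreal (norm (partial_deriv \<alpha> (F n) x - weak_partial \<omega> \<alpha> (a3 \<omega> \<psi>) x) powr p) \<partial>?M) \<longlonglongrightarrow> 0"
    using tr unfolding has_trace_def by blast
  have "(\<integral>\<^sup>+x. ennreal (norm (partial_deriv \<alpha> (F n) x - weak_partial \<omega> \<alpha> (a3 \<omega> \<psi>) x) powr p) \<partial>?M) =
      (\<integral>\<^sup>+x. ennreal (norm (partial_deriv \<alpha> (F n) x - f' \<alpha> x) powr p) \<partial>?M)" for \<alpha> n
    using f''[of \<alpha>] by (intro nn_integral_cong_AE) (auto elim: eventually_mono)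
  then have F': "(\<lambda>n. \<integral>\<^sup>+x. ennreal (norm (partial_deriv \<alpha> (F n) x - f' \<alpha> x) powr p) \<partial>?M) \<longlonglongrightarrow> 0" for \<alpha>
    using F(3) by simp
  have orth: "AE x in ?M. a3 \<omega> \<psi> x \<bullet> g' \<alpha> x = 0" for \<alpha>
    using g''[of \<alpha>] by eventually_elim (metis a3_inner_weak_partial)
  have "a3 \<omega> \<psi> \<in> Lp p \<omega>" using a by (simp add: sobolev1_def)
  from null_lagrangian_symmetric[OF \<omega> p this f'(1) g'(1,2) F(1,2) F' orth]
  have "AE x in ?M. f' \<alpha> x \<bullet> g' \<beta> x = f' \<beta> x \<bullet> g' \<alpha> x" .
  then show ?thesis using f''[of \<alpha>] f''[of \<beta>] g''[of \<alpha>] g''[of \<beta>]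
    by eventually_elim (simp add: form_b_def inner_commute)
qed

section \<open>The reference shell\<close>

lemma eigenvalue_char_poly_2:
  fixes A :: "real^2^2"
  assumes "k \<in> eigenvalues A"
  shows "(A $ 1 $ 1 - k) * (A $ 2 $ 2 - k) = A $ 1 $ 2 * A $ 2 $ 1"
proof -
  obtain v where v: "v \<noteq> 0" "A *v v = k *\<^sub>R v" using assms by (auto simp: eigenvalues_def)
  have e: "(A $ 1 $ 1 - k) * v $ 1 = - A $ 1 $ 2 * v $ 2" "(A $ 2 $ 2 - k) * v $ 2 = - A $ 2 $ 1 * v $ 1"
    using arg_cong[OF v(2), of "\<lambda>w. w $ 1"] arg_cong[OF v(2), of "\<lambda>w. w $ 2"]
    by (simp_all add: matrix_vector_mult_def sum_2 algebra_simps)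
  have "((A $ 1 $ 1 - k) * (A $ 2 $ 2 - k)) * v $ 1 = (A $ 1 $ 2 * A $ 2 $ 1) * v $ 1"
       "((A $ 1 $ 1 - k) * (A $ 2 $ 2 - k)) * v $ 2 = (A $ 1 $ 2 * A $ 2 $ 1) * v $ 2"
    using e by algebra+
  moreover have "v $ 1 \<noteq> 0 \<or> v $ 2 \<noteq> 0" using v(1) by (auto simp: vec_eq_iff forall_2)
  ultimately show ?thesis by auto
qed

text \<open>Two eigenvalues are roots of one quadratic, so given k the other can only be the trace
  minus k. Finiteness is what gives \<open>Min\<close> and \<open>Max\<close> in the principal
  curvatures their meaning.\<close>

lemma finite_eigenvalues_2: "finite (eigenvalues (A :: real^2^2))"
proof (cases "eigenvalues A = {}")
  case False
  then obtain k where k: "k \<in> eigenvalues A" by blast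
  have "m \<in> {k, A $ 1 $ 1 + A $ 2 $ 2 - k}" if "m \<in> eigenvalues A" for m
  proof -
    have "(m - k) * (m - (A $ 1 $ 1 + A $ 2 $ 2 - k)) = 0"
      using eigenvalue_char_poly_2[OF k] eigenvalue_char_poly_2[OF that] by algebra
    then show ?thesis by auto
  qed
  then show ?thesis by (meson finite.simps finite_subset subsetI)
qed simp

lemma eigenvalue_mixed_b_bound:
  assumes k: "k \<in> eigenvalues (mixed_b \<omega> \<phi> x)" and \<epsilon>: "\<epsilon> > 0"
    and curv: "\<bar>\<epsilon> * curvature1 \<omega> \<phi> x\<bar> < 1" "\<bar>\<epsilon> * curvature2 \<omega> \<phi> x\<bar> < 1"
  shows "\<bar>\<epsilon> * k\<bar> < 1"
proof -
  have "curvature1 \<omega> \<phi> x \<le> k" "k \<le> curvature2 \<omega> \<phi> x"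
    using k finite_eigenvalues_2 by (auto simp: curvature1_def curvature2_def)
  then have "\<epsilon> * curvature1 \<omega> \<phi> x \<le> \<epsilon> * k" "\<epsilon> * k \<le> \<epsilon> * curvature2 \<omega> \<phi> x"
    using \<epsilon> by auto
  then show ?thesis using curv by linarith
qed

text \<open>Lagrange's identity for the cross product.\<close>

lemma det_form_a: "det (form_a \<omega> \<phi> x) = area \<omega> \<phi> x"
  unfolding area_def normal_field_def norm_cross
  by (simp add: det_2 form_a_def dot_square_norm inner_commute power2_eq_square)

lemma matrix_inv_mult_self:
  fixes A :: "real^'n^'n"
  assumes "invertible A"
  shows "matrix_inv A ** A = mat 1"
  using someI_ex[OF assms[unfolded invertible_def]] unfolding matrix_inv_def by blast

text \<open>
  A nontrivial relation \<open>c\<close> between the tangent vectors at height \<open>v\<close> makes \<open>1/v\<close> a principal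
  curvature, with eigenvector \<open>(a\<^sub>\<alpha>\<^sub>\<beta>) c\<close>.
\<close>
lemma g_cov_independent:
  assumes area: "area \<omega> \<phi> x \<noteq> 0" and \<epsilon>: "\<epsilon> > 0" and v: "\<bar>v\<bar> \<le> \<epsilon>"
    and curv: "\<bar>\<epsilon> * curvature1 \<omega> \<phi> x\<bar> < 1" "\<bar>\<epsilon> * curvature2 \<omega> \<phi> x\<bar> < 1"
    and c: "(\<Sum>\<alpha>\<in>UNIV. c $ \<alpha> *\<^sub>R g_cov \<omega> \<phi> x v \<alpha>) = 0"
  shows "c = 0"
proof -
  define A where "A = form_a \<omega> \<phi> x"
  define B where "B = form_b \<omega> \<phi> x"
  have inv: "invertible A" using area by (simp add: A_def invertible_det_nz det_form_a)
  have Ac: "A *v c = v *\<^sub>R (B *v c)"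
  \<comment> \<open>The relation is tested against each tangent vector of the midsurface: the scalar
    products with the a_\<alpha> give A c, those with the derivatives of \<open>a3\<close> give -B
    c.\<close>
  proof (rule vec_eq_iff[THEN iffD2], intro allI)
    fix \<beta>
    have "weak_partial \<omega> \<beta> \<phi> x \<bullet> (\<Sum>\<alpha>\<in>UNIV. c $ \<alpha> *\<^sub>R g_cov \<omega> \<phi> x v \<alpha>) = (A *v c) $ \<beta> - v * (B *v c) $ \<beta>"
      by (simp add: g_cov_def A_def B_def form_a_def form_b_def matrix_vector_mult_def sum_2 inner_add algebra_simps)
    then show "(A *v c) $ \<beta> = (v *\<^sub>R (B *v c)) $ \<beta>" by (simp add: c)
  qed
  define d where "d = A *v c"
  have cd: "c = matrix_inv A *v d"
    by (simp add: d_def matrix_vector_mul_assoc matrix_inv_mult_self[OF inv])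
  have d: "d = v *\<^sub>R (mixed_b \<omega> \<phi> x *v d)"
  proof -
    have "mixed_b \<omega> \<phi> x *v d = B *v (matrix_inv A *v d)"
      by (simp add: mixed_b_def A_def B_def matrix_vector_mul_assoc)
    then have mb: "mixed_b \<omega> \<phi> x *v d = B *v c" by (simp only: cd[symmetric])
    show ?thesis unfolding mb by (rule Ac[folded d_def])
  qed
  have "d = 0"
  proof (rule ccontr)
    assume "d \<noteq> 0"
    then have v0: "v \<noteq> 0" using d by auto
    then have "mixed_b \<omega> \<phi> x *v d = (1 / v) *\<^sub>R d"
      using arg_cong[OF d, of "\<lambda>w. (1 / v) *\<^sub>R w"] by simp
    then have "1 / v \<in> eigenvalues (mixed_b \<omega> \<phi> x)" using \<open>d \<noteq> 0\<close> by (auto simp: eigenvalues_def)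
    then have "\<bar>\<epsilon> * (1 / v)\<bar> < 1" by (rule eigenvalue_mixed_b_bound[OF _ \<epsilon> curv])
    then show False using v0 v \<epsilon> by (simp add: abs_divide field_simps)
  qed
  then show "c = 0" using cd by simp
qed

text \<open>Cramer's rule with the Gram determinant D. If D = 0, the vector u with |u|^2 = |g_2|^2 D
  vanishes and is a relation with nonzero coefficient |g_2|^2. Uniqueness: the difference of two
  solutions lies in the span and is orthogonal to it.\<close>

lemma dual_basis_2:
  fixes g :: "2 \<Rightarrow> 'a::real_inner"
  assumes ind: "\<And>c :: real^2. (\<Sum>\<alpha>\<in>UNIV. c $ \<alpha> *\<^sub>R g \<alpha>) = 0 \<Longrightarrow> c = 0"
  shows "\<exists>!w. w \<in> span (range g) \<and> (\<forall>\<beta>. w \<bullet> g \<beta> = (if \<alpha> = \<beta> then 1 else 0))"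
proof -
  define D where "D = (g 1 \<bullet> g 1) * (g 2 \<bullet> g 2) - (g 1 \<bullet> g 2)\<^sup>2"
  have nz: "g 2 \<noteq> 0"
  proof
    assume "g 2 = 0"
    then have "vector [0, 1] = (0 :: real^2)" by (intro ind) (simp add: sum_2)
    then show False by (metis vector_2(2) zero_index zero_neq_one)
  qed
  have D: "D \<noteq> 0"
  proof
    assume D0: "D = 0"
    define u where "u = (g 2 \<bullet> g 2) *\<^sub>R g 1 - (g 1 \<bullet> g 2) *\<^sub>R g 2"
    have "u \<bullet> u = (g 2 \<bullet> g 2) * D"
      by (simp add: u_def D_def inner_diff inner_commute power2_eq_square algebra_simps)
    then have "u = 0" using D0 by simp
    then have "vector [g 2 \<bullet> g 2, - (g 1 \<bullet> g 2)] = (0 :: real^2)"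
      by (intro ind) (simp add: sum_2 u_def)
    then have "g 2 \<bullet> g 2 = 0" by (metis vector_2(1) zero_index)
    then show False using nz by simp
  qed
  define w where "w = (if \<alpha> = 1 then (1 / D) *\<^sub>R ((g 2 \<bullet> g 2) *\<^sub>R g 1 - (g 1 \<bullet> g 2) *\<^sub>R g 2)
                       else (1 / D) *\<^sub>R ((g 1 \<bullet> g 1) *\<^sub>R g 2 - (g 1 \<bullet> g 2) *\<^sub>R g 1))"
  have w: "w \<in> span (range g)"
    by (simp add: w_def span_scale span_diff span_base)
  have "w \<bullet> g \<beta> = (if \<alpha> = \<beta> then 1 else 0)" for \<beta>
    using exhaust_2[of \<alpha>] exhaust_2[of \<beta>] D
    by (auto simp: w_def inner_diff inner_commute D_def power2_eq_square divide_simps; simp add: algebra_simps)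
  moreover have "w' = w''" if "w' \<in> span (range g)" "\<forall>\<beta>. w' \<bullet> g \<beta> = (if \<alpha> = \<beta> then 1 else 0)"
      "w'' \<in> span (range g)" "\<forall>\<beta>. w'' \<bullet> g \<beta> = (if \<alpha> = \<beta> then 1 else 0)" for w' w''
  proof -
    have "orthogonal (w' - w'') (w' - w'')"
      using that by (intro orthogonal_to_span[of "w' - w''" "range g"])
        (auto simp: orthogonal_def inner_diff span_diff)
    then show ?thesis by (simp add: orthogonal_self)
  qed
  ultimately show ?thesis using w by blast
qed

lemma g_contra_inner_g_cov:
  assumes "area \<omega> \<phi> x \<noteq> 0" "\<epsilon> > 0" "\<bar>v\<bar> \<le> \<epsilon>"
    and "\<bar>\<epsilon> * curvature1 \<omega> \<phi> x\<bar> < 1" "\<bar>\<epsilon> * curvature2 \<omega> \<phi> x\<bar> < 1"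
  shows "g_contra \<omega> \<phi> x v \<alpha> \<bullet> g_cov \<omega> \<phi> x v \<beta> = (if \<alpha> = \<beta> then 1 else 0)"
proof -
  have "\<exists>!w. w \<in> span (range (g_cov \<omega> \<phi> x v)) \<and>
      (\<forall>\<beta>. w \<bullet> g_cov \<omega> \<phi> x v \<beta> = (if \<alpha> = \<beta> then 1 else 0))"
    by (rule dual_basis_2) (rule g_cov_independent[OF assms])
  from theI'[OF this] show ?thesis unfolding g_contra_def[symmetric] by blast
qed

section \<open>Almost everywhere bounds on the reference shell\<close>

lemma G1_area_curvature:
  assumes "\<phi> \<in> G1 \<omega> \<epsilon>"
  shows "AE x in lebesgue_on \<omega>. area \<omega> \<phi> x \<noteq> 0 \<and>
    \<bar>\<epsilon> * curvature1 \<omega> \<phi> x\<bar> < 1 \<and> \<bar>\<epsilon> * curvature2 \<omega> \<phi> x\<bar> < 1"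
proof -
  let ?M = "lebesgue_on \<omega>"
  have E: "esssup ?M (\<lambda>x. - ereal (norm (normal_field \<omega> \<phi> x))) < 0"
    using assms by (simp add: G1_def essinf_def ereal_less_uminus_reorder)
  have 1: "AE x in ?M. - ereal (norm (normal_field \<omega> \<phi> x)) < 0"
    using esssup_AE[of "\<lambda>x. - ereal (norm (normal_field \<omega> \<phi> x))" ?M]
    by eventually_elim (rule le_less_trans[OF _ E])
  have E1: "esssup ?M (\<lambda>x. ereal \<bar>\<epsilon> * curvature1 \<omega> \<phi> x\<bar>) < 1"
    and E2: "esssup ?M (\<lambda>x. ereal \<bar>\<epsilon> * curvature2 \<omega> \<phi> x\<bar>) < 1"
    using assms by (simp_all add: G1_def)
  have 2: "AE x in ?M. ereal \<bar>\<epsilon> * curvature1 \<omega> \<phi> x\<bar> < 1"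
    using esssup_AE[of "\<lambda>x. ereal \<bar>\<epsilon> * curvature1 \<omega> \<phi> x\<bar>" ?M]
    by eventually_elim (rule le_less_trans[OF _ E1])
  have 3: "AE x in ?M. ereal \<bar>\<epsilon> * curvature2 \<omega> \<phi> x\<bar> < 1"
    using esssup_AE[of "\<lambda>x. ereal \<bar>\<epsilon> * curvature2 \<omega> \<phi> x\<bar>" ?M]
    by eventually_elim (rule le_less_trans[OF _ E2])
  from 1 2 3 show ?thesis by eventually_elim (auto simp: area_def)
qed

lemma Linf_AE_bounded:
  assumes "f \<in> Linf \<omega>"
  obtains B where "AE x in lebesgue_on \<omega>. norm (f x) \<le> B"
proof -
  have "esssup (lebesgue_on \<omega>) (\<lambda>x. ereal (norm (f x))) < \<infinity>" using assms by (simp add: Linf_def)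
  then obtain B where B: "esssup (lebesgue_on \<omega>) (\<lambda>x. ereal (norm (f x))) \<le> ereal B"
    by (metis less_ereal.simps(2) ereal_less_eq(1) less_PInf_Ex_of_nat less_imp_le)
  have "AE x in lebesgue_on \<omega>. norm (f x) \<le> B"
    using esssup_AE[of "\<lambda>x. ereal (norm (f x))" "lebesgue_on \<omega>"]
    by eventually_elim (use B order_trans in \<open>fastforce simp flip: ereal_less_eq(3)\<close>)
  then show ?thesis using that by blast
qed

lemma W1inf_weak_partial_bounded:
  assumes "open \<omega>" "f \<in> W1inf \<omega>"
  obtains B where "AE x in lebesgue_on \<omega>. \<forall>\<alpha>. norm (weak_partial \<omega> \<alpha> f x) \<le> B"
proof -
  have "\<exists>B. AE x in lebesgue_on \<omega>. norm (weak_partial \<omega> \<alpha> f x) \<le> B" for \<alpha>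
  proof -
    obtain g where g: "g \<in> Linf \<omega>" "AE x in lebesgue_on \<omega>. weak_partial \<omega> \<alpha> f x = g x"
      using sobolev1_weak_partial[OF assms] by blast
    obtain B where "AE x in lebesgue_on \<omega>. norm (g x) \<le> B" using Linf_AE_bounded[OF g(1)] .
    with g(2) have "AE x in lebesgue_on \<omega>. norm (weak_partial \<omega> \<alpha> f x) \<le> B" by eventually_elim simp
    then show ?thesis by blast
  qed
  then obtain B where B: "\<And>\<alpha>. AE x in lebesgue_on \<omega>. norm (weak_partial \<omega> \<alpha> f x) \<le> B \<alpha>" by metis
  have "AE x in lebesgue_on \<omega>. norm (weak_partial \<omega> \<alpha> f x) \<le> max (B 1) (B 2)" for \<alpha>
    using B[of \<alpha>] by eventually_elim (use exhaust_2[of \<alpha>] in auto)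
  then have "AE x in lebesgue_on \<omega>. \<forall>\<alpha>. norm (weak_partial \<omega> \<alpha> f x) \<le> max (B 1) (B 2)"
    by (simp add: AE_all_countable)
  then show ?thesis using that by blast
qed

lemma G1_g_cov_bounded:
  assumes \<omega>: "open \<omega>" and \<phi>: "\<phi> \<in> G1 \<omega> \<epsilon>"
  obtains m where "m > 0" "AE x in lebesgue_on \<omega>. \<forall>v \<alpha>. \<bar>v\<bar> \<le> \<epsilon> \<longrightarrow> norm (g_cov \<omega> \<phi> x v \<alpha>) \<le> m"
proof -
  have W: "\<phi> \<in> W1inf \<omega>" "a3 \<omega> \<phi> \<in> W1inf \<omega>" using \<phi> by (auto simp: G1_def)
  obtain B1 where B1: "AE x in lebesgue_on \<omega>. \<forall>\<alpha>. norm (weak_partial \<omega> \<alpha> \<phi> x) \<le> B1"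
    using W1inf_weak_partial_bounded[OF \<omega> W(1)] .
  obtain B2 where B2: "AE x in lebesgue_on \<omega>. \<forall>\<alpha>. norm (weak_partial \<omega> \<alpha> (a3 \<omega> \<phi>) x) \<le> B2"
    using W1inf_weak_partial_bounded[OF \<omega> W(2)] .
  \<comment> \<open>Absolute values, since \<open>B1\<close> and \<open>B2\<close> are not known to
    be nonnegative; the added 1 makes the bound strictly positive, as the coercivity constant
    divides by a power of it.\<close>
  have "AE x in lebesgue_on \<omega>. \<forall>v \<alpha>. \<bar>v\<bar> \<le> \<epsilon> \<longrightarrow> norm (g_cov \<omega> \<phi> x v \<alpha>) \<le> \<bar>B1\<bar> + \<bar>\<epsilon>\<bar> * \<bar>B2\<bar> + 1"
    using B1 B2
  proof eventually_elim
    case (elim x)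
    show ?case
    proof (intro allI impI)
      fix v \<alpha> assume v: "\<bar>v\<bar> \<le> \<epsilon>"
      have "norm (g_cov \<omega> \<phi> x v \<alpha>) \<le> norm (weak_partial \<omega> \<alpha> \<phi> x) + \<bar>v\<bar> * norm (weak_partial \<omega> \<alpha> (a3 \<omega> \<phi>) x)"
        unfolding g_cov_def by (rule order_trans[OF norm_triangle_ineq]) simp
      also have "\<dots> \<le> \<bar>B1\<bar> + \<bar>\<epsilon>\<bar> * \<bar>B2\<bar>"
        using elim v by (intro add_mono mult_mono) (auto intro: order_trans[OF _ abs_ge_self])
      finally show "norm (g_cov \<omega> \<phi> x v \<alpha>) \<le> \<bar>B1\<bar> + \<bar>\<epsilon>\<bar> * \<bar>B2\<bar> + 1" by simp
    qed
  qed
  moreover have "\<bar>B1\<bar> + \<bar>\<epsilon>\<bar> * \<bar>B2\<bar> + 1 > 0"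
    by (intro add_nonneg_pos add_nonneg_nonneg mult_nonneg_nonneg) auto
  ultimately show ?thesis using that by blast
qed

section \<open>The tensors as Gram matrices\<close>

text \<open>The matrix F as a function of two arbitrary matrices in place of the gradients, with the
  contravariant vectors as parameters: convexity is required on all of \<open>M_set\<close>.\<close>

definition gram_root :: "(2 \<Rightarrow> real^3) \<Rightarrow> real \<Rightarrow> real^2^3 \<Rightarrow> real^2^3 \<Rightarrow> real^3^3" where
  "gram_root g u A B = (\<Sum>\<alpha>\<in>UNIV. tensor (column \<alpha> A + u *\<^sub>R column \<alpha> B) (g \<alpha>))"

lemma column_grad: "column \<alpha> (grad \<omega> \<psi> x) = weak_partial \<omega> \<alpha> \<psi> x"
  by (simp add: column_def grad_def vec_eq_iff)

lemma gram_root_linear: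
  "gram_root g u (s *\<^sub>R A + t *\<^sub>R A') (s *\<^sub>R B + t *\<^sub>R B') = s *\<^sub>R gram_root g u A B + t *\<^sub>R gram_root g u A' B'"
  by (simp add: gram_root_def tensor_def column_def vec_eq_iff sum_2 algebra_simps)

text \<open>Expanding the scalar product of the vectors f_\<alpha> and f_\<beta> produces -u times
  the sum of \<open>form_b\<close> and its transpose; the symmetry hypothesis turns this into the
  term with -2 u in \<open>G_tensor\<close>.\<close>

lemma G_tensor_eq_gram:
  assumes sym: "\<And>\<alpha> \<beta>. form_b \<omega> \<psi> x $ \<alpha> $ \<beta> = form_b \<omega> \<psi> x $ \<beta> $ \<alpha>"
  shows "G_tensor \<omega> \<phi> x \<psi> u v =
    transpose (gram_root (g_contra \<omega> \<phi> x v) u (grad \<omega> \<psi> x) (grad \<omega> (a3 \<omega> \<psi>) x)) **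
    gram_root (g_contra \<omega> \<phi> x v) u (grad \<omega> \<psi> x) (grad \<omega> (a3 \<omega> \<psi>) x)"
proof -
  define f where "f \<alpha> = weak_partial \<omega> \<alpha> \<psi> x + u *\<^sub>R weak_partial \<omega> \<alpha> (a3 \<omega> \<psi>) x" for \<alpha>
  define g where "g = g_contra \<omega> \<phi> x v"
  have coeff: "form_a \<omega> \<psi> x $ \<alpha> $ \<beta> - 2 * u * form_b \<omega> \<psi> x $ \<alpha> $ \<beta> + u\<^sup>2 * form_c \<omega> \<psi> x $ \<alpha> $ \<beta> = f \<alpha> \<bullet> f \<beta>"
    for \<alpha> \<beta>
  proof -
    have "f \<alpha> \<bullet> f \<beta> = form_a \<omega> \<psi> x $ \<alpha> $ \<beta> - u * form_b \<omega> \<psi> x $ \<alpha> $ \<beta> - u * form_b \<omega> \<psi> x $ \<beta> $ \<alpha>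
        + u\<^sup>2 * form_c \<omega> \<psi> x $ \<alpha> $ \<beta>"
      by (simp add: f_def form_a_def form_b_def form_c_def inner_add inner_commute power2_eq_square algebra_simps)
    then show ?thesis by (simp add: sym[of \<beta> \<alpha>])
  qed
  have F: "gram_root g u (grad \<omega> \<psi> x) (grad \<omega> (a3 \<omega> \<psi>) x) = (\<Sum>\<alpha>\<in>UNIV. tensor (f \<alpha>) (g \<alpha>))"
    by (simp add: gram_root_def f_def column_grad)
  have "G_tensor \<omega> \<phi> x \<psi> u v = (\<Sum>\<alpha>\<in>UNIV. \<Sum>\<beta>\<in>UNIV. (f \<alpha> \<bullet> f \<beta>) *\<^sub>R tensor (g \<alpha>) (g \<beta>))"
    by (simp only: G_tensor_def coeff g_def)
  also have "\<dots> = transpose (\<Sum>\<alpha>\<in>UNIV. tensor (f \<alpha>) (g \<alpha>)) ** (\<Sum>\<alpha>\<in>UNIV. tensor (f \<alpha>) (g \<alpha>))"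
    by (simp add: vec_eq_iff tensor_def transpose_def matrix_matrix_mult_def sum_2 sum_3 inner_vec_def algebra_simps)
  finally show ?thesis by (simp only: F g_def[symmetric])
qed

lemma gram_root_mult_dual:
  assumes "\<And>\<alpha> \<beta>. g \<alpha> \<bullet> h \<beta> = (if \<alpha> = \<beta> then 1 else 0)"
  shows "gram_root g u A B *v h \<beta> = column \<beta> (A + u *\<^sub>R B)"
proof -
  have "gram_root g u A B *v h \<beta> = column \<beta> A + u *\<^sub>R column \<beta> B"
    unfolding gram_root_def sum_matrix_mult_vector[OF finite] tensor_mult_vector assms
    by (simp add: if_distrib[of "\<lambda>c. c *\<^sub>R _"] cong: if_cong)
  then show ?thesis by (simp add: column_def vec_eq_iff)
qed

lemma frobenius_eq_norm: "frobenius A = norm A"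
proof -
  have "trace (transpose A ** A) = A \<bullet> A"
    unfolding trace_def matrix_matrix_mult_def transpose_def inner_vec_def
    by (simp, rule sum.swap)
  then show ?thesis by (simp add: frobenius_def norm_eq_sqrt_inner)
qed

section \<open>Norm inequalities for the lower bound\<close>

lemma norm_le_sum_columns_2:
  fixes A :: "real^2^'m"
  shows "norm A \<le> norm (column 1 A) + norm (column 2 A)"
proof (rule power2_le_imp_le)
  have "(norm A)\<^sup>2 = (norm (column 1 A))\<^sup>2 + (norm (column 2 A))\<^sup>2"
    by (simp add: power2_norm_eq_inner inner_vec_def column_def sum_2 sum.distrib)
  also have "\<dots> \<le> (norm (column 1 A) + norm (column 2 A))\<^sup>2"
    by (simp add: power2_sum)
  finally show "(norm A)\<^sup>2 \<le> (norm (column 1 A) + norm (column 2 A))\<^sup>2" .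
qed simp

lemma powr_add_le_two_powr:
  fixes a b r :: real
  assumes "a \<ge> 0" "b \<ge> 0" "r \<ge> 0"
  shows "(a + b) powr r \<le> 2 powr r * (a powr r + b powr r)"
proof -
  have "(a + b) powr r \<le> (2 * max a b) powr r" using assms by (intro powr_mono2) auto
  also have "\<dots> = 2 powr r * (max a b) powr r" using assms by (simp add: powr_mult)
  also have "\<dots> \<le> 2 powr r * (a powr r + b powr r)"
    by (intro mult_left_mono) (auto simp: max_def)
  finally show ?thesis .
qed

text \<open>Applying the Gram root to the dual vector h_\<beta> recovers column \<beta> of A + u B,
  whose r-th power costs m powr r. The factor 2 powr r comes from the power of a sum of two column
  norms, the factor 2 from adding the two bounds.\<close>

lemma norm_powr_le_trace_gram_root:
  assumes dual: "\<And>\<alpha> \<beta>. g \<alpha> \<bullet> h \<beta> = (if \<alpha> = \<beta> then 1 else 0)"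
    and h: "\<And>\<alpha>. norm (h \<alpha>) \<le> m" and r: "r \<ge> 2"
  shows "norm (A + u *\<^sub>R B) powr r \<le> 2 powr r * (2 * m powr r) *
    trace (mat_powr (transpose (gram_root g u A B) ** gram_root g u A B) (r / 2))"
proof -
  define T where "T = trace (mat_powr (transpose (gram_root g u A B) ** gram_root g u A B) (r / 2))"
  have T0: "T \<ge> 0" unfolding T_def by (intro trace_mat_powr_nonneg transpose_gram)
  have "norm (column \<beta> (A + u *\<^sub>R B)) powr r \<le> m powr r * T" for \<beta>
  proof -
    have "norm (gram_root g u A B *v h \<beta>) powr r \<le> norm (h \<beta>) powr r * T"
      using norm_powr_le_trace_gram[of "r / 2" "gram_root g u A B" "h \<beta>"] r by (simp add: T_def)
    also have "\<dots> \<le> m powr r * T" using T0 h r by (intro mult_right_mono powr_mono2) auto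
    finally show ?thesis by (simp add: gram_root_mult_dual[OF dual])
  qed
  note col = this
  have "norm (A + u *\<^sub>R B) powr r \<le> (norm (column 1 (A + u *\<^sub>R B)) + norm (column 2 (A + u *\<^sub>R B))) powr r"
    using norm_le_sum_columns_2 r by (intro powr_mono2) auto
  also have "\<dots> \<le> 2 powr r * (norm (column 1 (A + u *\<^sub>R B)) powr r + norm (column 2 (A + u *\<^sub>R B)) powr r)"
    using r by (intro powr_add_le_two_powr) auto
  also have "\<dots> \<le> 2 powr r * (m powr r * T + m powr r * T)"
    by (intro mult_left_mono add_mono col) simp
  finally show ?thesis by (simp add: T_def)
qed

text \<open>A and B are half the sum and half the difference of A + B and A - B, so both norms are
  at most the larger of the two.\<close>

lemma norm_powr_le_sum_diff:
  fixes A B :: "'a::real_normed_vector"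
  assumes "r \<ge> 0"
  shows "norm A powr r + norm B powr r \<le> 2 * (norm (A + B) powr r + norm (A - B) powr r)"
proof -
  have "2 * norm A \<le> norm (A + B) + norm (A - B)" "2 * norm B \<le> norm (A + B) + norm (A - B)"
    using norm_triangle_ineq[of "A + B" "A - B"] norm_triangle_ineq4[of "A + B" "A - B"]
    by (simp_all flip: scaleR_2)
  moreover define m where "m = max (norm (A + B)) (norm (A - B))"
  ultimately have "norm A \<le> m" "norm B \<le> m" by linarith+
  then have "norm A powr r + norm B powr r \<le> m powr r + m powr r"
    using assms by (intro add_mono powr_mono2) auto
  moreover have "m powr r \<le> norm (A + B) powr r + norm (A - B) powr r"
    by (simp add: m_def max_def)
  then have "m powr r + m powr r \<le> 2 * (norm (A + B) powr r + norm (A - B) powr r)"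
    by simp
  ultimately show ?thesis by (rule order_trans)
qed

section \<open>Polyconvexity and coercivity\<close>

text \<open>Splitting each absolute value into its two signs exhibits the set as an intersection of
  four open half-spaces.\<close>

lemma convex_N_set: "convex N_set"
proof -
  have eq: "N_set = {z. (1, -1, 0) \<bullet> z > 0} \<inter> {z. (1, 1, 0) \<bullet> z > 0} \<inter>
      {z. (1, -2, 1) \<bullet> z > 0} \<inter> {z. (1, 2, 1) \<bullet> z > 0}"
    by (auto simp: N_set_def)
  show ?thesis unfolding eq by (intro convex_Int convex_halfspace_gt)
qed

lemma M_set_iff: "(A, B, z) \<in> M_set \<longleftrightarrow> z \<in> N_set"
  by (cases z) (simp add: M_set_def N_set_def)

lemma convex_M_set: "convex M_set"
proof (rule convexI)
  fix X Y :: "(real^2^3) \<times> (real^2^3) \<times> real \<times> real \<times> real" and s t :: real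
  assume "X \<in> M_set" "Y \<in> M_set" "0 \<le> s" "0 \<le> t" "s + t = 1"
  moreover obtain A B z A' B' z' where "X = (A, B, z)" "Y = (A', B', z')" by (metis prod_cases3)
  ultimately show "s *\<^sub>R X + t *\<^sub>R Y \<in> M_set"
    using convexD[OF convex_N_set] by (simp add: M_set_iff)
qed

text \<open>With the scaled curvatures k and l the triple is s (1, (k + l)/2, k l). The second
  inequality of \<open>N_set\<close> is the positivity of (1 - k)(1 - l) and (1 + k)(1 + l), one for
  each sign of k + l.\<close>

lemma curv_args_mem_N_set:
  assumes "area \<omega> \<psi> x \<noteq> 0" "max \<bar>\<epsilon> * curvature1 \<omega> \<psi> x\<bar> \<bar>\<epsilon> * curvature2 \<omega> \<psi> x\<bar> < 1"
  shows "curv_args \<omega> \<epsilon> \<psi> x \<in> N_set"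
proof -
  define s where "s = sqrt (area \<omega> \<psi> x)"
  define k l where "k = \<epsilon> * curvature1 \<omega> \<psi> x" and "l = \<epsilon> * curvature2 \<omega> \<psi> x"
  have s: "s > 0" using assms(1) by (simp add: s_def area_def)
  have kl: "\<bar>k\<bar> < 1" "\<bar>l\<bar> < 1" using assms(2) by (simp_all add: k_def l_def)
  have args: "curv_args \<omega> \<epsilon> \<psi> x = (s, (k + l) / 2 * s, k * l * s)"
    by (simp add: curv_args_def s_def k_def l_def mean_curv_def gauss_curv_def power2_eq_square algebra_simps)
  have "(1 - k) * (1 - l) > 0" "(1 + k) * (1 + l) > 0" using kl by (auto intro!: mult_pos_pos)
  then have "1 - \<bar>k + l\<bar> + k * l > 0" by (simp add: algebra_simps abs_if)
  then have "s * (1 - \<bar>k + l\<bar> + k * l) > 0" using s by simp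
  moreover have "s * (1 - \<bar>k + l\<bar> / 2) > 0" using s kl by simp
  moreover have "\<bar>(k + l) / 2 * s\<bar> = \<bar>k + l\<bar> / 2 * s" using s by (simp add: abs_mult)
  ultimately show ?thesis by (simp add: args N_set_def algebra_simps)
qed

lemma convex_on_sum_fun:
  assumes "finite I" "convex S" "\<And>i. i \<in> I \<Longrightarrow> convex_on S (f i)"
  shows "convex_on S (\<lambda>x. \<Sum>i\<in>I. f i x)"
  using assms by (induction I rule: finite_induct) (auto intro: convex_on_add simp: convex_on_const)

lemma convex_on_trace_gram_root:
  assumes "s \<ge> 1"
  shows "convex_on M_set (\<lambda>(A, B, z). trace (mat_powr (transpose (gram_root g u A B) ** gram_root g u A B) s))"
proof (rule convex_onI)
  fix t :: real and X Y :: "(real^2^3) \<times> (real^2^3) \<times> real \<times> real \<times> real" assume t: "0 < t" "t < 1"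
  obtain A B z A' B' z' where XY: "X = (A, B, z)" "Y = (A', B', z')" by (metis prod_cases3)
  show "(case (1 - t) *\<^sub>R X + t *\<^sub>R Y of (A, B, z) \<Rightarrow> trace (mat_powr (transpose (gram_root g u A B) ** gram_root g u A B) s))
      \<le> (1 - t) * (case X of (A, B, z) \<Rightarrow> trace (mat_powr (transpose (gram_root g u A B) ** gram_root g u A B) s)) +
        t * (case Y of (A, B, z) \<Rightarrow> trace (mat_powr (transpose (gram_root g u A B) ** gram_root g u A B) s))"
    using convex_onD[OF convex_on_trace_gram_powr[OF assms], of t "gram_root g u A B" "gram_root g u A' B'"] t
    by (simp add: XY gram_root_linear)
qed (rule convex_M_set)

lemma convex_on_M_set_if_convex_on_N_set:
  assumes "convex_on N_set f"
  shows "convex_on M_set (\<lambda>(A, B, z). f z)"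
proof (rule convex_onI)
  fix t :: real and X Y :: "(real^2^3) \<times> (real^2^3) \<times> real \<times> real \<times> real"
  assume t: "0 < t" "t < 1" and "X \<in> M_set" "Y \<in> M_set"
  moreover obtain A B z A' B' z' where "X = (A, B, z)" "Y = (A', B', z')" by (metis prod_cases3)
  ultimately show "(case (1 - t) *\<^sub>R X + t *\<^sub>R Y of (A, B, z) \<Rightarrow> f z)
      \<le> (1 - t) * (case X of (A, B, z) \<Rightarrow> f z) + t * (case Y of (A, B, z) \<Rightarrow> f z)"
    using convex_onD[OF assms, of t z z'] by (simp add: M_set_iff)
qed (rule convex_M_set)

theorem theorem2:
  fixes \<omega> \<gamma>\<^sub>0 :: "(real^2) set"
    and \<epsilon> p q :: real
    and \<phi> :: "real^2 \<Rightarrow> real^3"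
    and \<Gamma> :: "real^2 \<Rightarrow> real \<times> real \<times> real \<Rightarrow> real"
    and R :: nat
    and a b \<gamma> u v w :: "nat \<Rightarrow> real"
    and W :: "real^2 \<Rightarrow> (real^2 \<Rightarrow> real^3) \<Rightarrow> real"
  defines "V \<equiv> admissible \<omega> \<epsilon> p q \<gamma>\<^sub>0 \<phi>"
  assumes "lipschitz_domain \<omega>"
    and "\<epsilon> > 0" and "p \<ge> 2" and "q > 1"
    and "openin (top_of_set (frontier \<omega>)) \<gamma>\<^sub>0" and "\<gamma>\<^sub>0 \<noteq> {}"
    and "\<phi> \<in> G1 \<omega> \<epsilon>"
    and "AE x in lebesgue_on \<omega>. convex_on N_set (\<Gamma> x)"
    and "R \<ge> 1"
    and "\<And>i. i \<in> {1..R} \<Longrightarrow>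
           a i > 0 \<and> b i > 0 \<and> \<gamma> i \<ge> 2 \<and> v i \<in> {-\<epsilon>..\<epsilon>} \<and> w i \<in> {-\<epsilon>..\<epsilon>}"
    and "\<And>x \<psi>. x \<in> \<omega> \<Longrightarrow> \<psi> \<in> V \<Longrightarrow>
           W x \<psi> =
             (\<Sum>i = 1..R. a i * trace (mat_powr (G_tensor \<omega> \<phi> x \<psi> (u i) (v i)) (\<gamma> i / 2)) +
                          b i * trace (mat_powr (G_tensor \<omega> \<phi> x \<psi> (- u i) (w i)) (\<gamma> i / 2))) +
             \<Gamma> x (curv_args \<omega> \<epsilon> \<psi> x)"
  shows "polyconvex \<omega> \<epsilon> V W \<and>
    (\<forall>i\<^sub>0\<in>{1..R}. \<gamma> i\<^sub>0 = Max (\<gamma> ` {1..R}) \<longrightarrow>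
       (\<exists>C>0. \<forall>\<psi>\<in>V. AE x in lebesgue_on \<omega>.
          W x \<psi> \<ge> C * (frobenius (grad \<omega> \<psi> x) powr \<gamma> i\<^sub>0 +
                      \<bar>u i\<^sub>0\<bar> powr \<gamma> i\<^sub>0 * frobenius (grad \<omega> (a3 \<omega> \<psi>) x) powr \<gamma> i\<^sub>0) +
                 \<Gamma> x (curv_args \<omega> \<epsilon> \<psi> x)))"
proof -
  let ?M = "lebesgue_on \<omega>"
  have \<omega>: "open \<omega>" "bounded \<omega>" using assms(2) by (auto simp: lipschitz_domain_def)
  have par: "a i > 0" "b i > 0" "\<gamma> i \<ge> 2" "\<bar>v i\<bar> \<le> \<epsilon>" "\<bar>w i\<bar> \<le> \<epsilon>" if "i \<in> {1..R}" for i
    using assms(11)[OF that] by auto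
  define T where "T g u' s A B = trace (mat_powr (transpose (gram_root g u' A B) ** gram_root g u' A B) s)"
    for g u' s A B
  have T_nonneg: "T g u' s A B \<ge> 0" for g u' s A B
    unfolding T_def by (intro trace_mat_powr_nonneg transpose_gram)
  define S where "S x i A B = a i * T (g_contra \<omega> \<phi> x (v i)) (u i) (\<gamma> i / 2) A B +
      b i * T (g_contra \<omega> \<phi> x (w i)) (- u i) (\<gamma> i / 2) A B" for x i A B
  \<comment> \<open>The exceptional null set comes from the symmetry of \<open>form_b\<close> and
    depends on \<psi>; both conclusions quantify over \<psi> outside the almost everywhere, so this
    is harmless.\<close>
  have W_eq: "AE x in ?M. W x \<psi> =
      (\<Sum>i = 1..R. S x i (grad \<omega> \<psi> x) (grad \<omega> (a3 \<omega> \<psi>) x)) + \<Gamma> x (curv_args \<omega> \<epsilon> \<psi> x)"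
    if \<psi>: "\<psi> \<in> V" for \<psi>
  proof -
    obtain t where "has_trace p \<omega> (a3 \<omega> \<psi>) t"
      using \<psi> unfolding V_def admissible_def trace_eq_on_def by blast
    moreover have "\<psi> \<in> W1p p \<omega>" "a3 \<omega> \<psi> \<in> W1p p \<omega>"
      using \<psi> unfolding V_def admissible_def by blast+
    ultimately have "AE x in ?M. form_b \<omega> \<psi> x $ \<alpha> $ \<beta> = form_b \<omega> \<psi> x $ \<beta> $ \<alpha>" for \<alpha> \<beta>
      using form_b_symmetric[OF \<omega> assms(4)] by blast
    then have "AE x in ?M. \<forall>\<alpha> \<beta>. form_b \<omega> \<psi> x $ \<alpha> $ \<beta> = form_b \<omega> \<psi> x $ \<beta> $ \<alpha>"
      by (simp add: AE_all_countable)
    then show ?thesis using AE_space[of ?M]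
    proof eventually_elim
      case (elim x)
      have "x \<in> \<omega>" using elim(2) by simp
      moreover have "form_b \<omega> \<psi> x $ \<alpha> $ \<beta> = form_b \<omega> \<psi> x $ \<beta> $ \<alpha>" for \<alpha> \<beta>
        using elim(1) by blast
      ultimately show ?case
        by (simp only: assms(12)[OF _ \<psi>] G_tensor_eq_gram S_def T_def)
    qed
  qed
  have "polyconvex \<omega> \<epsilon> V W"
    unfolding polyconvex_def
  proof (intro exI conjI ballI)
    \<comment> \<open>The midsurface \<phi> enters through the contravariant vectors, which are
      fixed once x is. The exceptional set for convexity is therefore that of \<Gamma> and is
      independent of \<psi>.\<close>
    let ?WW = "\<lambda>x X. (\<Sum>i = 1..R. (case X of (A, B, z) \<Rightarrow> S x i A B)) + (case X of (A, B, z) \<Rightarrow> \<Gamma> x z)"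
    have S_conv: "convex_on M_set (\<lambda>X. case X of (A, B, z) \<Rightarrow> S x i A B)" if i: "i \<in> {1..R}" for x i
    proof -
      have "convex_on M_set (\<lambda>X. a i * (case X of (A, B, z) \<Rightarrow> T (g_contra \<omega> \<phi> x (v i)) (u i) (\<gamma> i / 2) A B) +
          b i * (case X of (A, B, z) \<Rightarrow> T (g_contra \<omega> \<phi> x (w i)) (- u i) (\<gamma> i / 2) A B))"
        unfolding T_def using par[OF i]
        by (intro convex_on_add convex_on_cmul convex_on_trace_gram_root) auto
      then show ?thesis by (simp add: S_def case_prod_unfold)
    qed
    show "AE x in ?M. convex_on M_set (?WW x)"
      using assms(9)
    proof eventually_elim
      case (elim x)
      then show ?case
        by (intro convex_on_add convex_on_sum_fun S_conv convex_on_M_set_if_convex_on_N_set convex_M_set) auto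
    qed
    fix \<psi> assume \<psi>: "\<psi> \<in> V"
    then have "AE x in ?M. area \<omega> \<psi> x \<noteq> 0"
        "AE x in ?M. max \<bar>\<epsilon> * curvature1 \<omega> \<psi> x\<bar> \<bar>\<epsilon> * curvature2 \<omega> \<psi> x\<bar> < 1"
      unfolding V_def admissible_def by blast+
    with W_eq[OF \<psi>] show "AE x in ?M. (grad \<omega> \<psi> x, grad \<omega> (a3 \<omega> \<psi>) x, curv_args \<omega> \<epsilon> \<psi> x) \<in> M_set \<and>
        W x \<psi> = ?WW x (grad \<omega> \<psi> x, grad \<omega> (a3 \<omega> \<psi>) x, curv_args \<omega> \<epsilon> \<psi> x)"
      by eventually_elim (simp add: M_set_iff curv_args_mem_N_set)
  qed
  moreover have "\<exists>C>0. \<forall>\<psi>\<in>V. AE x in ?M.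
      W x \<psi> \<ge> C * (frobenius (grad \<omega> \<psi> x) powr \<gamma> i +
                  \<bar>u i\<bar> powr \<gamma> i * frobenius (grad \<omega> (a3 \<omega> \<psi>) x) powr \<gamma> i) + \<Gamma> x (curv_args \<omega> \<epsilon> \<psi> x)"
    if i: "i \<in> {1..R}" for i
  proof -
    obtain m where m: "m > 0"
        "AE x in ?M. \<forall>v \<alpha>. \<bar>v\<bar> \<le> \<epsilon> \<longrightarrow> norm (g_cov \<omega> \<phi> x v \<alpha>) \<le> m"
      using G1_g_cov_bounded[OF \<omega>(1) assms(8)] .
    \<comment> \<open>K is the constant of \<open>norm_powr_le_trace_gram_root\<close>, and the
      extra 2 in C that of \<open>norm_powr_le_sum_diff\<close>. As m depends on the reference shell
      alone, C can be chosen before \<psi>.\<close>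
    define K where "K = 2 powr \<gamma> i * (2 * m powr \<gamma> i)"
    define C where "C = min (a i) (b i) / (2 * K)"
    have K: "K > 0" using m(1) by (simp add: K_def)
    have C: "C > 0" using K par[OF i] by (simp add: C_def)
    show ?thesis
    proof (intro exI[of _ C] conjI C ballI)
      fix \<psi> assume \<psi>: "\<psi> \<in> V"
      show "AE x in ?M. W x \<psi> \<ge> C * (frobenius (grad \<omega> \<psi> x) powr \<gamma> i +
                  \<bar>u i\<bar> powr \<gamma> i * frobenius (grad \<omega> (a3 \<omega> \<psi>) x) powr \<gamma> i) + \<Gamma> x (curv_args \<omega> \<epsilon> \<psi> x)"
        using W_eq[OF \<psi>] G1_area_curvature[OF assms(8)] m(2)
      proof eventually_elim
        case (elim x)
        define A where "A = grad \<omega> \<psi> x"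
        define B where "B = grad \<omega> (a3 \<omega> \<psi>) x"
        \<comment> \<open>The height h affects only the pair of dual bases, and the recovered matrix
          A + s B does not involve it; so the heights v_i and w_i of the terms with u_i and -u_i may
          differ.\<close>
        have bound: "norm (A + s *\<^sub>R B) powr \<gamma> i \<le> K * T (g_contra \<omega> \<phi> x h) s (\<gamma> i / 2) A B"
          if h: "\<bar>h\<bar> \<le> \<epsilon>" for s h
          unfolding K_def T_def
          using elim(2,3) h par(3)[OF i] assms(3)
          by (intro norm_powr_le_trace_gram_root[where h = "g_cov \<omega> \<phi> x h"] g_contra_inner_g_cov) auto
        define T1 where "T1 = T (g_contra \<omega> \<phi> x (v i)) (u i) (\<gamma> i / 2) A B"
        define T2 where "T2 = T (g_contra \<omega> \<phi> x (w i)) (- u i) (\<gamma> i / 2) A B"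
        have T0: "T1 \<ge> 0" "T2 \<ge> 0" by (simp_all add: T1_def T2_def T_nonneg)
        have "norm A powr \<gamma> i + norm (u i *\<^sub>R B) powr \<gamma> i
            \<le> 2 * (norm (A + u i *\<^sub>R B) powr \<gamma> i + norm (A - u i *\<^sub>R B) powr \<gamma> i)"
          using par(3)[OF i] by (intro norm_powr_le_sum_diff) simp
        also have "\<dots> \<le> 2 * (K * T1 + K * T2)"
          using bound[OF par(4)[OF i], of "u i"] bound[OF par(5)[OF i], of "- u i"]
          by (simp add: T1_def T2_def)
        also have "\<dots> = 2 * K * (T1 + T2)" by (simp add: algebra_simps)
        finally have "C * (norm A powr \<gamma> i + norm (u i *\<^sub>R B) powr \<gamma> i) \<le> C * (2 * K * (T1 + T2))"
          using C by (intro mult_left_mono) auto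
        also have "\<dots> = min (a i) (b i) * T1 + min (a i) (b i) * T2"
          using K by (simp add: C_def algebra_simps)
        also have "\<dots> \<le> a i * T1 + b i * T2"
          using T0 by (intro add_mono mult_right_mono) auto
        also have "\<dots> = S x i A B" by (simp add: S_def T1_def T2_def)
        also have "\<dots> \<le> (\<Sum>i = 1..R. S x i A B)"
        proof (rule member_le_sum[OF i])
          show "0 \<le> S x j A B" if "j \<in> {1..R} - {i}" for j
            using par[of j] that T_nonneg unfolding S_def by (intro add_nonneg_nonneg mult_nonneg_nonneg) auto
        qed simp
        finally show ?case
          using elim(1) by (simp add: A_def B_def frobenius_eq_norm powr_mult)
      qed
    qed
  qed
  ultimately show ?thesis by blast
qed

end
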